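(* Let $k$ be an infinite field and let $V \subseteq k^n$ be an affine algebraic set. Let $I = I(V) \subseteq k[X_1,\ldots,X_n]$ and $R = k[X_1,\ldots,X_n]/I$. Then $V$ is fundamental if and only if $R$ is unit-additive, and $V$ is locally fundamental if and only if $R$ is locally unit-additive.
   Context: Rings are commutative with identity. $k^{\mathrm{alg}}$ denotes an algebraic closure of $k$. An affine algebraic set $V\subseteq k^n$ is a set of the form $\{p\in k^n : f(p)=0 \text{ for all } f\in Z\}$ for some $Z\subseteq k[X_1,\ldots,X_n]$. Affine algebraic sets are the closed sets of the Zariski topology on $k^n$, and $V$ carries the subspace topology. For $Y \subseteq k^n$, $I(Y)=\{f\in k[X_1,\ldots,X_n] : f(p)=0 \text{ for all } p\in Y\}$. Let $W$ be the Zariski closure of $V$ in $(k^{\mathrm{alg}})^n$. $V$ is fundamental (over $k$) if for every $f\in k[X_1,\ldots,X_n]$ that is not constant on $V$ there is $p\in W$ with $f(p)=0$. $V$ is locally fundamental if for every $f\in k[X_1,\ldots,X_n]$ that is not locally constant on $V$ (in the Zariski topology) there is $p\in W$ with $f(p)=0$. A ring $R$ is unit-additive if for all units $u,v$ of $R$, $u+v$ is a unit or nilpotent (the zero ring is unit-additive). A ring $R$ is locally unit-additive if it satisfies one (equivalently, all) of the following: (1) $R_{\mathrm{red}}=R/\mathrm{nil}(R)$ is isomorphic to a finite product of unit-additive rings; (2) there is a subset $S\subseteq R$ generating the unit ideal such that $R_f$ is unit-additive for all $f\in S$; (3) there is an affine open cover $\mathcal{C}$ of $\operatorname{Spec} R$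 such that $\mathcal{O}_{\operatorname{Spec} R}(U)$ is unit-additive for all $U\in\mathcal{C}$. *)

theory Defs
  imports
    "HOL-Algebra.Algebraic_Closure_Type"
    "HOL-Algebra.Chinese_Remainder"
    "HOL-Library.Poly_Mapping"
    "HOL-Analysis.Abstract_Topology_2"
begin

section \<open>Affine space and polynomials in n variables\<close>

text \<open>
  The variables \<open>X\<^sub>1, \<dots>, X\<^sub>n\<close> are indexed by \<open>{..<n}\<close>; \<open>n = 0\<close> is allowed. Points are
  functions that are \<open>undefined\<close> outside \<open>{..<n}\<close>, so that \<open>k\<^sup>n\<close> has no redundant points.
\<close>

definition affine_space :: "nat \<Rightarrow> (nat \<Rightarrow> 'k) set" where
  "affine_space n = {..<n} \<rightarrow>\<^sub>E UNIV"

type_synonym 'k mpoly = "(nat \<Rightarrow>\<^sub>0 nat) \<Rightarrow>\<^sub>0 'k"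

definition mpolys :: "nat \<Rightarrow> 'k::zero mpoly set" where
  "mpolys n = {f. \<forall>m \<in> Poly_Mapping.keys f. Poly_Mapping.keys m \<subseteq> {..<n}}"

definition mpoly_eval :: "'k::comm_ring_1 mpoly \<Rightarrow> (nat \<Rightarrow> 'k) \<Rightarrow> 'k" where
  "mpoly_eval f p =
     (\<Sum>m \<in> Poly_Mapping.keys f. Poly_Mapping.lookup f m *
        (\<Prod>i \<in> Poly_Mapping.keys m. p i ^ Poly_Mapping.lookup m i))"

definition mpoly_ring :: "nat \<Rightarrow> 'k::comm_ring_1 mpoly ring" where
  "mpoly_ring n = ring_of_type_algebra\<lparr>carrier := mpolys n\<rparr>"


section \<open>Algebraic sets and the Zariski topology\<close>

definition algebraic_set :: "nat \<Rightarrow> (nat \<Rightarrow> 'k::comm_ring_1) set \<Rightarrow> bool" where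
  "algebraic_set n V \<longleftrightarrow>
     (\<exists>Z \<subseteq> mpolys n. V = {p \<in> affine_space n. \<forall>f \<in> Z. mpoly_eval f p = 0})"

definition vanishing_ideal :: "nat \<Rightarrow> (nat \<Rightarrow> 'k::comm_ring_1) set \<Rightarrow> 'k mpoly set" where
  "vanishing_ideal n Y = {f \<in> mpolys n. \<forall>p \<in> Y. mpoly_eval f p = 0}"

definition coordinate_ring :: "nat \<Rightarrow> (nat \<Rightarrow> 'k::comm_ring_1) set \<Rightarrow> 'k mpoly set ring" where
  "coordinate_ring n V = mpoly_ring n Quot vanishing_ideal n V"

text \<open>
  The constructor \<open>topology\<close> is only meaningful on predicates satisfying \<open>istopology\<close>; see
  \<open>openin_zariski\<close> and \<open>closedin_zariski\<close> below.
\<close>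

definition zariski :: "nat \<Rightarrow> (nat \<Rightarrow> 'k::idom) topology" where
  "zariski n = topology (\<lambda>U. U \<subseteq> affine_space n \<and> algebraic_set n (affine_space n - U))"

definition locally_constant_on_space :: "'p topology \<Rightarrow> ('p \<Rightarrow> 'b) \<Rightarrow> bool" where
  "locally_constant_on_space T f \<longleftrightarrow>
     (\<forall>x \<in> topspace T. \<exists>U. openin T U \<and> x \<in> U \<and> f constant_on U)"


section \<open>Fundamental algebraic sets\<close>

definition point_to_ac :: "nat \<Rightarrow> (nat \<Rightarrow> 'k::field) \<Rightarrow> nat \<Rightarrow> 'k alg_closure" where
  "point_to_ac n p = (\<lambda>i \<in> {..<n}. to_ac (p i))"

definition mpoly_to_ac :: "'k::field mpoly \<Rightarrow> 'k alg_closure mpoly" where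
  "mpoly_to_ac f = Poly_Mapping.map to_ac f"

definition ac_closure :: "nat \<Rightarrow> (nat \<Rightarrow> 'k::field) set \<Rightarrow> (nat \<Rightarrow> 'k alg_closure) set" where
  "ac_closure n V = Abstract_Topology.closure_of (zariski n) (point_to_ac n ` V)"

definition fundamental :: "nat \<Rightarrow> (nat \<Rightarrow> 'k::field) set \<Rightarrow> bool" where
  "fundamental n V \<longleftrightarrow>
     (\<forall>f \<in> mpolys n. \<not> mpoly_eval f constant_on V \<longrightarrow>
        (\<exists>p \<in> ac_closure n V. mpoly_eval (mpoly_to_ac f) p = 0))"

definition locally_fundamental :: "nat \<Rightarrow> (nat \<Rightarrow> 'k::field) set \<Rightarrow> bool" where
  "locally_fundamental n V \<longleftrightarrow>
     (\<forall>f \<in> mpolys n.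
        \<not> locally_constant_on_space (subtopology (zariski n) V) (mpoly_eval f) \<longrightarrow>
        (\<exists>p \<in> ac_closure n V. mpoly_eval (mpoly_to_ac f) p = 0))"


section \<open>Unit-additive rings\<close>

definition nilradical :: "('a, 'm) ring_scheme \<Rightarrow> 'a set" where
  "nilradical R = {x \<in> carrier R. \<exists>m::nat. x [^]\<^bsub>R\<^esub> m = \<zero>\<^bsub>R\<^esub>}"

definition unit_additive :: "('a, 'm) ring_scheme \<Rightarrow> bool" where
  "unit_additive R \<longleftrightarrow> cring R \<and>
     (\<forall>u \<in> Units R. \<forall>v \<in> Units R. u \<oplus>\<^bsub>R\<^esub> v \<in> Units R \<or> u \<oplus>\<^bsub>R\<^esub> v \<in> nilradical R)"

text \<open>
  The existential quantifier ranges over factor rings whose elements have type \<open>'a set\<close>, the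
  element type of \<open>R Quot nilradical R\<close>. This loses no generality, as the factors of a product
  embed into it: see \<open>locally_unit_additiveI\<close> below. The empty product is the zero ring.
\<close>

definition locally_unit_additive :: "('a, 'm) ring_scheme \<Rightarrow> bool" where
  "locally_unit_additive R \<longleftrightarrow> cring R \<and>
     (\<exists>Rs :: 'a set ring list.
        (\<forall>S \<in> set Rs. unit_additive S) \<and> R Quot nilradical R \<simeq> RDirProd_list Rs)"


section \<open>Evaluation and the polynomial ring\<close>

lemma mpoly_eval_superset:
  assumes "finite A" "Poly_Mapping.keys f \<subseteq> A"
  shows "mpoly_eval f p = (\<Sum>m\<in>A. Poly_Mapping.lookup f m *
           (\<Prod>i \<in> Poly_Mapping.keys m. p i ^ Poly_Mapping.lookup m i))"
  unfolding mpoly_eval_def using assms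
  by (intro sum.mono_neutral_left) (auto simp: in_keys_iff)

lemma mpoly_eval_zero [simp]: "mpoly_eval 0 p = 0"
  by (simp add: mpoly_eval_def)

lemma mpoly_eval_one [simp]: "mpoly_eval 1 p = 1"
  by (simp add: mpoly_eval_def)

lemma mpoly_eval_single:
  "mpoly_eval (Poly_Mapping.single m c) p =
     c * (\<Prod>i \<in> Poly_Mapping.keys m. p i ^ Poly_Mapping.lookup m i)"
  by (cases "c = 0") (simp_all add: mpoly_eval_def)

lemma mpoly_eval_add [simp]: "mpoly_eval (f + g) p = mpoly_eval f p + mpoly_eval g p"
proof -
  let ?A = "Poly_Mapping.keys f \<union> Poly_Mapping.keys g"
  have "Poly_Mapping.keys (f + g) \<subseteq> ?A" by (rule keys_add)
  then show ?thesis
    by (simp add: mpoly_eval_superset[of ?A] lookup_add distrib_right sum.distrib)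
qed

lemma mpoly_eval_uminus [simp]: "mpoly_eval (- f) p = - mpoly_eval f p"
  using mpoly_eval_add[of f "- f" p] by (simp add: eq_neg_iff_add_eq_0 add.commute)

lemma mpoly_eval_sum: "mpoly_eval (\<Sum>x\<in>A. f x) p = (\<Sum>x\<in>A. mpoly_eval (f x) p)"
  by (induction A rule: infinite_finite_induct) auto

lemma mpoly_eq_sum_single:
  "f = (\<Sum>m\<in>Poly_Mapping.keys f. Poly_Mapping.single m (Poly_Mapping.lookup f m))"
proof (rule poly_mapping_eqI)
  fix k
  have "Poly_Mapping.lookup (\<Sum>m\<in>Poly_Mapping.keys f.
          Poly_Mapping.single m (Poly_Mapping.lookup f m)) k
      = (\<Sum>m\<in>Poly_Mapping.keys f. if m = k then Poly_Mapping.lookup f m else 0)"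
    by (simp add: lookup_sum lookup_single when_def)
  also have "\<dots> = Poly_Mapping.lookup f k"
    by (simp add: in_keys_iff)
  finally show "Poly_Mapping.lookup f k = Poly_Mapping.lookup (\<Sum>m\<in>Poly_Mapping.keys f.
          Poly_Mapping.single m (Poly_Mapping.lookup f m)) k" by simp
qed

lemma mpoly_eval_times_single:
  "mpoly_eval (Poly_Mapping.single m a * Poly_Mapping.single l b) p
   = mpoly_eval (Poly_Mapping.single m a) p * mpoly_eval (Poly_Mapping.single l b) p"
proof -
  let ?A = "Poly_Mapping.keys m \<union> Poly_Mapping.keys l"
  have *: "(\<Prod>i\<in>Poly_Mapping.keys x. p i ^ Poly_Mapping.lookup x i)
      = (\<Prod>i\<in>?A. p i ^ Poly_Mapping.lookup x i)" if "Poly_Mapping.keys x \<subseteq> ?A" for x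
    using that by (intro prod.mono_neutral_left) (auto simp: in_keys_iff)
  have ml: "Poly_Mapping.keys (m + l) \<subseteq> ?A" by (rule keys_add)
  show ?thesis
    unfolding mult_single mpoly_eval_single *[OF Un_upper1] *[OF Un_upper2] *[OF ml]
    by (simp add: lookup_add power_add prod.distrib)
qed

lemma mpoly_eval_times [simp]: "mpoly_eval (f * g) p = mpoly_eval f p * mpoly_eval g p"
proof -
  let ?F = "\<lambda>f m. Poly_Mapping.single m (Poly_Mapping.lookup f m)"
  have "mpoly_eval (f * g) p = mpoly_eval
      ((\<Sum>m\<in>Poly_Mapping.keys f. ?F f m) * (\<Sum>l\<in>Poly_Mapping.keys g. ?F g l)) p"
    using mpoly_eq_sum_single[of f] mpoly_eq_sum_single[of g] by simp
  also have "\<dots> = mpoly_eval (\<Sum>m\<in>Poly_Mapping.keys f. ?F f m) p *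
      mpoly_eval (\<Sum>l\<in>Poly_Mapping.keys g. ?F g l) p"
    by (simp only: sum_product mpoly_eval_sum mpoly_eval_times_single)
  also have "\<dots> = mpoly_eval f p * mpoly_eval g p"
    using mpoly_eq_sum_single[of f] mpoly_eq_sum_single[of g] by simp
  finally show ?thesis .
qed

lemma mpolys_zero [simp]: "0 \<in> mpolys n"
  and mpolys_one [simp]: "1 \<in> mpolys n"
  by (auto simp: mpolys_def)

lemma mpolys_add: "f \<in> mpolys n \<Longrightarrow> g \<in> mpolys n \<Longrightarrow> f + g \<in> mpolys n"
  using keys_add[of f g] unfolding mpolys_def by blast

lemma mpolys_uminus: "f \<in> mpolys n \<Longrightarrow> - f \<in> mpolys n" for f :: "'k::ab_group_add mpoly"
  by (simp add: mpolys_def in_keys_iff)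

lemma mpolys_times:
  fixes f g :: "'k::comm_ring_1 mpoly"
  assumes "f \<in> mpolys n" "g \<in> mpolys n"
  shows "f * g \<in> mpolys n"
proof -
  have "Poly_Mapping.keys m \<subseteq> {..<n}" if "m \<in> Poly_Mapping.keys (f * g)" for m
  proof -
    have "\<exists>a b. m = a + b \<and> a \<in> Poly_Mapping.keys f \<and> b \<in> Poly_Mapping.keys g"
      using subsetD[OF keys_mult that] by auto
    then obtain a b where
      "m = a + b" "a \<in> Poly_Mapping.keys f" "b \<in> Poly_Mapping.keys g"
      by blast
    then show ?thesis using assms keys_add[of a b] unfolding mpolys_def by blast
  qed
  then show ?thesis by (auto simp: mpolys_def)
qed

lemma mpoly_ring_simps [simp]:
  "carrier (mpoly_ring n) = mpolys n"
  "f \<otimes>\<^bsub>mpoly_ring n\<^esub> g = f * g"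
  "f \<oplus>\<^bsub>mpoly_ring n\<^esub> g = f + g"
  "\<one>\<^bsub>mpoly_ring n\<^esub> = 1"
  "\<zero>\<^bsub>mpoly_ring n\<^esub> = 0"
  by (simp_all add: mpoly_ring_def ring_of_type_algebra_def)

lemma cring_mpoly_ring: "cring (mpoly_ring n :: 'k::comm_ring_1 mpoly ring)"
proof (rule cringI)
  show "abelian_group (mpoly_ring n :: 'k mpoly ring)"
  proof (rule abelian_groupI)
    fix x :: "'k mpoly" assume "x \<in> carrier (mpoly_ring n)"
    then show "\<exists>y\<in>carrier (mpoly_ring n). y \<oplus>\<^bsub>mpoly_ring n\<^esub> x = \<zero>\<^bsub>mpoly_ring n\<^esub>"
      by (intro bexI[of _ "- x"]) (auto intro: mpolys_uminus)
  qed (auto intro: mpolys_add simp: algebra_simps)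
  show "comm_monoid (mpoly_ring n :: 'k mpoly ring)"
    by (rule comm_monoidI) (auto intro: mpolys_times simp: algebra_simps)
qed (auto simp: algebra_simps)

lemma ideal_vanishing_ideal: "ideal (vanishing_ideal n Y) (mpoly_ring n)"
proof -
  interpret cring "mpoly_ring n :: 'a mpoly ring" by (rule cring_mpoly_ring)
  have inv: "\<ominus>\<^bsub>mpoly_ring n\<^esub> f = - f" if "f \<in> mpolys n" for f :: "'a mpoly"
    using that by (intro minus_equality) (auto intro: mpolys_uminus)
  show ?thesis
  proof (rule idealI)
    show "subgroup (vanishing_ideal n Y) (add_monoid (mpoly_ring n))"
      by (rule add.subgroupI)
        (auto simp: vanishing_ideal_def inv a_inv_def[symmetric] mpolys_add mpolys_uminus
              intro!: exI[of _ 0])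
  qed (auto simp: vanishing_ideal_def mpolys_times ring_axioms)
qed

lemma cring_coordinate_ring: "cring (coordinate_ring n V)"
  unfolding coordinate_ring_def
  by (rule ideal.quotient_is_cring[OF ideal_vanishing_ideal cring_mpoly_ring])


section \<open>The Zariski topology is a topology\<close>

lemma algebraic_set_subset: "algebraic_set n V \<Longrightarrow> V \<subseteq> affine_space n"
  by (auto simp: algebraic_set_def)

lemma algebraic_set_affine_space: "algebraic_set n (affine_space n)"
  unfolding algebraic_set_def by (rule exI[of _ "{}"]) auto

lemma algebraic_set_empty: "algebraic_set n {}"
  unfolding algebraic_set_def by (rule exI[of _ "{1}"]) auto

lemma algebraic_set_Un:
  fixes V W :: "(nat \<Rightarrow> 'k::idom) set"
  assumes "algebraic_set n V" "algebraic_set n W"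
  shows "algebraic_set n (V \<union> W)"
proof -
  obtain Y where Y: "Y \<subseteq> mpolys n" "V = {p \<in> affine_space n. \<forall>f \<in> Y. mpoly_eval f p = 0}"
    using assms(1) unfolding algebraic_set_def by blast
  obtain Z where Z: "Z \<subseteq> mpolys n" "W = {p \<in> affine_space n. \<forall>f \<in> Z. mpoly_eval f p = 0}"
    using assms(2) unfolding algebraic_set_def by blast
  let ?YZ = "{f * g | f g. f \<in> Y \<and> g \<in> Z}"
  have "?YZ \<subseteq> mpolys n"
    using Y(1) Z(1) mpolys_times by blast
  moreover have "V \<union> W = {p \<in> affine_space n. \<forall>h \<in> ?YZ. mpoly_eval h p = 0}" (is "_ = ?R")
  proof
    show "V \<union> W \<subseteq> ?R" using Y(2) Z(2) by auto
    show "?R \<subseteq> V \<union> W"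
    proof
      fix p assume p: "p \<in> ?R"
      show "p \<in> V \<union> W"
      proof (rule ccontr)
        assume "p \<notin> V \<union> W"
        then obtain f g where fg: "f \<in> Y" "mpoly_eval f p \<noteq> 0" "g \<in> Z" "mpoly_eval g p \<noteq> 0"
          using p Y(2) Z(2) by auto
        then have "mpoly_eval (f * g) p = 0" using p by blast
        then show False using fg by simp
      qed
    qed
  qed
  ultimately show ?thesis unfolding algebraic_set_def by blast
qed

lemma algebraic_set_mem_iff:
  assumes "algebraic_set n V"
  shows "p \<in> V \<longleftrightarrow> p \<in> affine_space n \<and> (\<forall>f \<in> vanishing_ideal n V. mpoly_eval f p = 0)"
proof -
  obtain Z where Z: "Z \<subseteq> mpolys n" "V = {p \<in> affine_space n. \<forall>f \<in> Z. mpoly_eval f p = 0}"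
    using assms unfolding algebraic_set_def by blast
  have "Z \<subseteq> vanishing_ideal n V"
    using Z by (auto simp: vanishing_ideal_def)
  then show ?thesis
    using Z(2) by (auto simp: vanishing_ideal_def)
qed

lemma algebraic_set_INT:
  fixes \<V> :: "(nat \<Rightarrow> 'k::comm_ring_1) set set"
  assumes "\<And>V. V \<in> \<V> \<Longrightarrow> algebraic_set n V"
  shows "algebraic_set n (affine_space n \<inter> \<Inter>\<V>)"
proof -
  have mem: "p \<in> V \<longleftrightarrow> p \<in> affine_space n \<and> (\<forall>f \<in> vanishing_ideal n V. mpoly_eval f p = 0)"
    if "V \<in> \<V>" for p V
    by (rule algebraic_set_mem_iff[OF assms[OF that]])
  have "affine_space n \<inter> \<Inter>\<V> =
      {p \<in> affine_space n. \<forall>f \<in> \<Union>(vanishing_ideal n ` \<V>). mpoly_eval f p = 0}"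
    using mem by auto
  moreover have "\<Union>(vanishing_ideal n ` \<V>) \<subseteq> mpolys n"
    by (auto simp: vanishing_ideal_def)
  ultimately show ?thesis
    unfolding algebraic_set_def by blast
qed

lemma istopology_zariski:
  "istopology (\<lambda>U :: (nat \<Rightarrow> 'k::idom) set.
     U \<subseteq> affine_space n \<and> algebraic_set n (affine_space n - U))"
  unfolding istopology_def
proof (intro conjI allI impI)
  fix S T :: "(nat \<Rightarrow> 'k) set"
  assume "S \<subseteq> affine_space n \<and> algebraic_set n (affine_space n - S)"
    and "T \<subseteq> affine_space n \<and> algebraic_set n (affine_space n - T)"
  then show "S \<inter> T \<subseteq> affine_space n" "algebraic_set n (affine_space n - S \<inter> T)"
    by (auto simp: Diff_Int intro: algebraic_set_Un)
next
  fix \<K> :: "(nat \<Rightarrow> 'k) set set"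
  assume K: "\<forall>K\<in>\<K>. K \<subseteq> affine_space n \<and> algebraic_set n (affine_space n - K)"
  then show "\<Union>\<K> \<subseteq> affine_space n" by blast
  have *: "affine_space n - \<Union>\<K> = affine_space n \<inter> \<Inter>((\<lambda>K. affine_space n - K) ` \<K>)"
    by blast
  show "algebraic_set n (affine_space n - \<Union>\<K>)"
    unfolding * by (rule algebraic_set_INT) (use K in blast)
qed

lemma openin_zariski:
  "openin (zariski n) U \<longleftrightarrow> U \<subseteq> affine_space n \<and> algebraic_set n (affine_space n - U)"
  unfolding zariski_def by (simp add: topology_inverse'[OF istopology_zariski])

lemma topspace_zariski [simp]: "topspace (zariski n) = affine_space n"
  unfolding topspace_def openin_zariski
  by (auto intro!: exI[of _ "affine_space n"] simp: algebraic_set_empty)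

lemma closedin_zariski: "closedin (zariski n) V \<longleftrightarrow> algebraic_set n V"
  using algebraic_set_subset[of n V]
  by (auto simp: closedin_def openin_zariski double_diff)


section \<open>Independence of the element type in the definition of local unit-additivity\<close>

lemma cring_iso:
  assumes "cring R" "h \<in> ring_iso R S" "\<zero>\<^bsub>S\<^esub> = h \<zero>\<^bsub>R\<^esub>"
  shows "cring S"
  using cring.ring_iso_imp_img_cring[OF assms(1,2)]
  unfolding assms(3)[symmetric] by simp

lemma ring_hom_Units_mem:
  assumes "ring R" "ring S" "h \<in> ring_hom R S" "u \<in> Units R"
  shows "h u \<in> Units S"
proof -
  obtain v where "u \<in> carrier R" "v \<in> carrier R" "v \<otimes>\<^bsub>R\<^esub> u = \<one>\<^bsub>R\<^esub>" "u \<otimes>\<^bsub>R\<^esub> v = \<one>\<^bsub>R\<^esub>"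
    using assms(4) unfolding Units_def by blast
  then have "h u \<in> carrier S" "h v \<in> carrier S"
    "h v \<otimes>\<^bsub>S\<^esub> h u = \<one>\<^bsub>S\<^esub>" "h u \<otimes>\<^bsub>S\<^esub> h v = \<one>\<^bsub>S\<^esub>"
    using ring_hom_memE[OF assms(3)] by metis+
  then show ?thesis unfolding Units_def by blast
qed

lemma ring_hom_nilradical:
  assumes "ring R" "ring S" "h \<in> ring_hom R S" "x \<in> nilradical R"
  shows "h x \<in> nilradical S"
proof -
  interpret ring_hom_ring R S h
    using assms(1-3) by (rule ring_hom_ringI2)
  obtain m :: nat where x: "x \<in> carrier R" "x [^]\<^bsub>R\<^esub> m = \<zero>\<^bsub>R\<^esub>"
    using assms(4) by (auto simp: nilradical_def)
  then have "h x [^]\<^bsub>S\<^esub> m = \<zero>\<^bsub>S\<^esub>"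
    by (metis hom_nat_pow hom_zero)
  with x show ?thesis by (auto simp: nilradical_def)
qed

lemma unit_additive_image_ring:
  assumes R: "unit_additive R" and inj: "inj_on f (carrier R)"
  shows "unit_additive (image_ring f R)"
proof -
  let ?S = "image_ring f R"
  have f: "f \<in> ring_iso R ?S" by (rule inj_imp_image_ring_iso[OF inj])
  have crR: "cring R" using R by (simp add: unit_additive_def)
  then interpret R: cring R .
  have crS: "cring ?S"
    by (rule cring_iso[OF crR f]) (simp add: image_ring_zero)
  then interpret S: cring ?S .
  have fh: "f \<in> ring_hom R ?S" using f by (simp add: ring_iso_def)
  let ?g = "inv_into (carrier R) f"
  have "?g \<in> ring_iso ?S R"
    by (rule ring_iso_set_sym[OF R.ring_axioms f])
  then have gh: "?g \<in> ring_hom ?S R" by (simp add: ring_iso_def)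
  have fg: "f (?g y) = y" if "y \<in> carrier ?S" for y
    using that by (simp add: image_ring_carrier f_inv_into_f)
  show ?thesis
    unfolding unit_additive_def
  proof (intro conjI ballI)
    fix u v assume uv: "u \<in> Units ?S" "v \<in> Units ?S"
    have gu: "?g u \<in> Units R" "?g v \<in> Units R"
      using ring_hom_Units_mem[OF S.ring_axioms R.ring_axioms gh] uv by blast+
    have "?g u \<oplus>\<^bsub>R\<^esub> ?g v \<in> Units R \<or> ?g u \<oplus>\<^bsub>R\<^esub> ?g v \<in> nilradical R"
      using R gu by (simp add: unit_additive_def)
    moreover have "f (?g u \<oplus>\<^bsub>R\<^esub> ?g v) = u \<oplus>\<^bsub>?S\<^esub> v"
      using ring_hom_memE(3)[OF fh] gu uv by (simp add: fg S.Units_closed R.Units_closed)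
    ultimately show "u \<oplus>\<^bsub>?S\<^esub> v \<in> Units ?S \<or> u \<oplus>\<^bsub>?S\<^esub> v \<in> nilradical ?S"
      using ring_hom_Units_mem[OF R.ring_axioms S.ring_axioms fh, of "?g u \<oplus>\<^bsub>R\<^esub> ?g v"]
        ring_hom_nilradical[OF R.ring_axioms S.ring_axioms fh, of "?g u \<oplus>\<^bsub>R\<^esub> ?g v"]
      by auto
  qed (rule crS)
qed

lemma RDirProd_list_image_iso:
  assumes "\<forall>S \<in> set Rs. \<exists>f. inj_on f (carrier S) \<and> P (image_ring f S)"
  shows "\<exists>Ts. (\<forall>T \<in> set Ts. P T) \<and> RDirProd_list Rs \<simeq> RDirProd_list Ts"
  using assms
proof (induction Rs)
  case Nil
  have "(\<lambda>_. []) \<in> ring_iso (RDirProd_list []) (RDirProd_list [])"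
    by (rule ring_iso_memI) (simp_all add: monoid.defs bij_betw_def)
  then show ?case
    unfolding is_ring_iso_def by (intro exI[of _ "[]"]) auto
next
  case (Cons R Rs)
  from Cons.IH Cons.prems obtain Ts h where
    Ts: "\<forall>T \<in> set Ts. P T" and h: "h \<in> ring_iso (RDirProd_list Rs) (RDirProd_list Ts)"
    by (auto simp: is_ring_iso_def)
  from Cons.prems obtain f where f: "inj_on f (carrier R)" "P (image_ring f R)"
    by auto
  have F: "(\<lambda>(r, s). (f r, h s)) \<in>
      ring_iso (RDirProd R (RDirProd_list Rs)) (RDirProd (image_ring f R) (RDirProd_list Ts))"
    by (rule RDirProd_iso6[OF inj_imp_image_ring_iso[OF f(1)] h])
  have "RDirProd_list (R # Rs) \<simeq> RDirProd_list (image_ring f R # Ts)"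
    using ring_iso_set_trans[OF ring_iso_set_trans[OF RDirProd_list_iso2 F] RDirProd_list_iso1]
    unfolding is_ring_iso_def by blast
  with Ts f(2) show ?case
    by (intro exI[of _ "image_ring f R # Ts"]) auto
qed

lemma RDirProd_list_factor_embeds:
  assumes "\<And>S. S \<in> set Rs \<Longrightarrow> ring S" "S \<in> set Rs"
  shows "\<exists>f. inj_on f (carrier S) \<and> f ` carrier S \<subseteq> carrier (RDirProd_list Rs)"
proof -
  obtain i where i: "i < length Rs" "S = Rs ! i"
    using assms(2) by (auto simp: in_set_conv_nth)
  let ?z = "map (\<lambda>T. \<zero>\<^bsub>T\<^esub>) Rs"
  let ?f = "\<lambda>x. ?z[i := x]"
  have "inj_on ?f (carrier S)"
    by (rule inj_onI) (metis i(1) length_map nth_list_update_eq)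
  moreover have "?f x \<in> carrier (RDirProd_list Rs)" if "x \<in> carrier S" for x
  proof (rule RDirProd_list_carrier_memI)
    fix j assume "j < length Rs"
    moreover from this have "\<zero>\<^bsub>Rs ! j\<^esub> \<in> carrier (Rs ! j)"
      using assms(1) by (simp add: ring.ring_simprules(2))
    ultimately show "?f x ! j \<in> carrier (Rs ! j)"
      using that i by (cases "j = i") auto
  qed simp
  ultimately show ?thesis by blast
qed

lemma locally_unit_additiveI:
  fixes R :: "('a, 'm) ring_scheme" and Rs :: "'b ring list"
  assumes "cring R" and Rs: "\<forall>S \<in> set Rs. unit_additive S"
    and iso: "R Quot nilradical R \<simeq> RDirProd_list Rs"
  shows "locally_unit_additive R"
proof -
  let ?Q = "R Quot nilradical R"
  obtain h where h: "bij_betw h (carrier ?Q) (carrier (RDirProd_list Rs))"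
    using iso by (auto simp: is_ring_iso_def ring_iso_def)
  have ring: "ring S" if "S \<in> set Rs" for S
    using Rs that by (auto simp: unit_additive_def cring_def)
  have "\<exists>f :: 'b \<Rightarrow> 'a set. inj_on f (carrier S) \<and> unit_additive (image_ring f S)"
    if S: "S \<in> set Rs" for S
  proof -
    obtain f where f: "inj_on f (carrier S)" "f ` carrier S \<subseteq> carrier (RDirProd_list Rs)"
      using RDirProd_list_factor_embeds[OF ring S] by blast
    let ?g = "inv_into (carrier ?Q) h"
    have "inj_on ?g (f ` carrier S)"
      using inj_on_subset[OF inj_on_inv_into[of "carrier (RDirProd_list Rs)" h "carrier ?Q"] f(2)]
        bij_betw_imp_surj_on[OF h] by blast
    then have "inj_on (?g \<circ> f) (carrier S)"
      using f(1) by (intro comp_inj_on)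
    moreover from this have "unit_additive (image_ring (?g \<circ> f) S)"
      using Rs S by (intro unit_additive_image_ring) auto
    ultimately show ?thesis by blast
  qed
  then obtain Ts :: "'a set ring list" where
    "\<forall>T \<in> set Ts. unit_additive T" "RDirProd_list Rs \<simeq> RDirProd_list Ts"
    using RDirProd_list_image_iso[of Rs unit_additive] by blast
  moreover have "?Q \<simeq> RDirProd_list Ts"
    using ring_iso_trans[OF iso calculation(2)] .
  ultimately show ?thesis
    using \<open>cring R\<close> unfolding locally_unit_additive_def by blast
qed

end

theory Submission
  imports Defs
begin

text \<open>
  By the Nullstellensatz, a polynomial over \<open>k\<close> has no zero in the closure \<open>W\<close> of \<open>V\<close> iff it is a
  unit of \<open>R\<close>. So \<open>V\<close> is (locally) fundamental iff every unit of \<open>R\<close> is (locally) constant on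
  \<open>V\<close>. If \<open>R\<close> is unit-additive and \<open>u\<close> is a unit, then \<open>u - u(v)\<close> is a sum of two units that
  vanishes at \<open>v\<close>, so it is zero; this also works on each factor of a product decomposition of
  \<open>R\<close>. Conversely, \<open>R\<close> is Noetherian, hence a finite product of rings with connected
  spectrum. A locally constant unit of \<open>R\<close> has finitely many values, so by interpolation its
  fibres have polynomial indicator functions; it is therefore constant on each factor.
\<close>

section \<open>Prime ideals of polynomial rings over a subring\<close>

text \<open>Two obstacles shape the proof. First, \<open>k\<close> need not be algebraically closed,
  so the points of V do not see all of Spec R: over the reals, the curves y = 0 and y = x^2 + 1 are
  disjoint, hence clopen in their union, yet they meet at complex points and no polynomial separates
  them. So V is split along polynomial indicator functions and not along its clopen subsets; a
  locally constant unit is itself polynomial, which is what lets interpolation produce such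
  indicators. For the same reason W has to be recognised as the zero set of I(V) over k^alg. Second,
  unit-additivity is lost in products. What survives is an identity s = s^2 w for sums s of two
  units, and it gives local constancy without following the points of V through the factors. The
  Nullstellensatz comes from extending homomorphisms one variable at a time. Pseudo-division modulo
  a prime replaces fraction fields, and the rings k[X_0], k[X_0, X_1], ... are subsets of one type,
  so that induction on the number of variables is possible.\<close>

locale comm_subring =
  fixes A :: "'a::comm_ring_1 set"
  assumes one_mem: "1 \<in> A"
    and diff_mem: "a \<in> A \<Longrightarrow> b \<in> A \<Longrightarrow> a - b \<in> A"
    and mult_mem: "a \<in> A \<Longrightarrow> b \<in> A \<Longrightarrow> a * b \<in> A"
begin

lemma zero_mem: "0 \<in> A"
  using diff_mem[OF one_mem one_mem] by simp

lemma uminus_mem: "a \<in> A \<Longrightarrow> - a \<in> A"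
  using diff_mem[OF zero_mem] by simp

lemma add_mem: "a \<in> A \<Longrightarrow> b \<in> A \<Longrightarrow> a + b \<in> A"
  using diff_mem[of a "- b"] uminus_mem by simp

lemma power_mem: "a \<in> A \<Longrightarrow> a ^ m \<in> A"
  by (induction m) (auto intro: one_mem mult_mem)

lemma sum_mem: "(\<And>i. i \<in> I \<Longrightarrow> f i \<in> A) \<Longrightarrow> sum f I \<in> A"
  by (induction I rule: infinite_finite_induct) (auto intro: zero_mem add_mem)

end

text \<open>A[X] as a subset of the ambient polynomial type, the same encoding as for
  \<open>A\<close>, so that results on \<open>comm_subring\<close> apply to A[X] in turn.\<close>

definition polys_over :: "'a::zero set \<Rightarrow> 'a poly set" where
  "polys_over A = {q. \<forall>i. coeff q i \<in> A}"

lemma coeff_mem: "q \<in> polys_over A \<Longrightarrow> coeff q i \<in> A"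
  by (simp add: polys_over_def)

lemma polys_over_monom: "0 \<in> A \<Longrightarrow> a \<in> A \<Longrightarrow> monom a n \<in> polys_over A"
  by (simp add: polys_over_def coeff_monom)

lemma polys_over_const: "0 \<in> A \<Longrightarrow> a \<in> A \<Longrightarrow> [:a:] \<in> polys_over A"
  using polys_over_monom[of A a 0] by (simp add: monom_0)

lemma (in comm_subring) comm_subring_polys_over: "comm_subring (polys_over A)"
proof
  show "1 \<in> polys_over A"
    using polys_over_const[OF zero_mem one_mem] by (simp add: one_pCons)
qed (auto simp: polys_over_def coeff_mult intro: diff_mem sum_mem mult_mem)

locale subring_ideal = comm_subring A for A :: "'a::comm_ring_1 set" +
  fixes J :: "'a set"
  assumes ideal_subset: "J \<subseteq> A"
    and ideal_zero: "0 \<in> J"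
    and ideal_add: "a \<in> J \<Longrightarrow> b \<in> J \<Longrightarrow> a + b \<in> J"
    and ideal_mult: "a \<in> A \<Longrightarrow> b \<in> J \<Longrightarrow> a * b \<in> J"
begin

lemma ideal_mult': "b \<in> J \<Longrightarrow> a \<in> A \<Longrightarrow> b * a \<in> J"
  using ideal_mult[of a b] by (simp add: mult.commute)

lemma ideal_uminus: "a \<in> J \<Longrightarrow> - a \<in> J"
  using ideal_mult[OF uminus_mem[OF one_mem]] by simp

lemma ideal_diff: "a \<in> J \<Longrightarrow> b \<in> J \<Longrightarrow> a - b \<in> J"
  using ideal_add[of a "- b"] ideal_uminus by simp

lemma ideal_sum: "(\<And>i. i \<in> I \<Longrightarrow> f i \<in> J) \<Longrightarrow> sum f I \<in> J"
  by (induction I rule: infinite_finite_induct) (auto intro: ideal_zero ideal_add)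

end

locale subring_prime = subring_ideal A P for A :: "'a::comm_ring_1 set" and P +
  assumes prime_one: "1 \<notin> P"
    and prime_mult: "a \<in> A \<Longrightarrow> b \<in> A \<Longrightarrow> a * b \<in> P \<Longrightarrow> a \<in> P \<or> b \<in> P"
begin

lemma prime_power: "a \<in> A \<Longrightarrow> a ^ m \<in> P \<Longrightarrow> a \<in> P"
  by (induction m) (use prime_one prime_mult power_mem in auto)

end

text \<open>A prime Q of A[X] lies over P = Q \<inter> A, and A[X]/Q is generated over the domain
  A/P by one element. The quotients are handled through representatives: zero modulo P reads as
  membership in \<open>P\<close> or \<open>polys_over P\<close>.\<close>

locale poly_prime = comm_subring A for A :: "'a::comm_ring_1 set" +
  fixes Q :: "'a poly set"
  assumes prime: "subring_prime (polys_over A) Q"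
begin

sublocale AX: comm_subring "polys_over A"
  by (rule comm_subring_polys_over)

sublocale Q: subring_prime "polys_over A" Q
  by (rule prime)

definition contraction :: "'a set" where
  "contraction = {a \<in> A. [:a:] \<in> Q}"

abbreviation "P \<equiv> contraction"

lemma const_mem: "a \<in> A \<Longrightarrow> [:a:] \<in> polys_over A"
  by (rule polys_over_const[OF zero_mem])

lemma smult_mem: "a \<in> A \<Longrightarrow> q \<in> polys_over A \<Longrightarrow> smult a q \<in> polys_over A"
  by (simp add: polys_over_def mult_mem)

sublocale P: subring_prime A contraction
proof
  show "1 \<notin> contraction" using Q.prime_one by (simp add: contraction_def one_pCons)
  fix a b assume "a \<in> A" "b \<in> A" "a * b \<in> contraction"
  then show "a \<in> contraction \<or> b \<in> contraction"
    using Q.prime_mult[OF const_mem const_mem, of a b] by (auto simp: contraction_def mult.commute)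
next
  fix a b assume "a \<in> A" "b \<in> contraction"
  then show "a * b \<in> contraction"
    using Q.ideal_mult[OF const_mem, of a "[:b:]"]
      by (auto simp: contraction_def mult_mem mult.commute)
next
  fix a b assume "a \<in> contraction" "b \<in> contraction"
  then show "a + b \<in> contraction"
    using Q.ideal_add[of "[:a:]" "[:b:]"] by (auto simp: contraction_def add_mem)
qed (auto simp: contraction_def Q.ideal_zero zero_mem)

lemma monom_mem_Q: "a \<in> P \<Longrightarrow> monom a n \<in> Q"
  using Q.ideal_mult'[of "[:a:]" "monom 1 n"] polys_over_monom[OF zero_mem one_mem]
  by (simp add: contraction_def smult_monom)

lemma polys_over_P_subset: "polys_over P \<subseteq> Q"
proof
  fix q assume "q \<in> polys_over P"
  then have "(\<Sum>i\<le>degree q. monom (coeff q i) i) \<in> Q"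
    by (intro Q.ideal_sum monom_mem_Q) (simp add: polys_over_def)
  then show "q \<in> Q" by (simp add: poly_as_sum_of_monoms)
qed

lemma subring_ideal_polys_over_P: "subring_ideal (polys_over A) (polys_over P)"
proof
  show "polys_over P \<subseteq> polys_over A"
    using P.ideal_subset by (auto simp: polys_over_def)
qed (auto simp: polys_over_def coeff_mult P.ideal_zero intro: P.ideal_add P.ideal_sum P.ideal_mult)

sublocale PX: subring_ideal "polys_over A" "polys_over P"
  by (rule subring_ideal_polys_over_P)

text \<open>The degree of q may exceed its degree modulo P. Cutting off the top terms with
  coefficients in P leaves a representative whose \<open>degree\<close> is the one over A/P.\<close>

lemma exists_truncation:
  assumes "q \<in> polys_over A" "q \<notin> polys_over P"
  shows "\<exists>q' \<in> polys_over A. lead_coeff q' \<notin> P \<and> q - q' \<in> polys_over P"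
proof -
  let ?S = "{i. coeff q i \<notin> P}"
  have "?S \<subseteq> {..degree q}"
    using P.ideal_zero coeff_eq_0[of q] by (force simp: not_le[symmetric])
  then have fin: "finite ?S" using finite_subset by blast
  have "?S \<noteq> {}" using assms(2) by (auto simp: polys_over_def)
  define N where "N = Max ?S"
  have N: "coeff q N \<notin> P" using Max_in[OF fin \<open>?S \<noteq> {}\<close>] by (simp add: N_def)
  have gt: "coeff q i \<in> P" if "i > N" for i
    using Max_ge[OF fin, of i] that by (auto simp: N_def)
  \<comment> \<open>\<open>poly_cutoff\<close> keeps the coefficients strictly below its first
    argument, hence \<open>Suc N\<close>.\<close>
  let ?q = "poly_cutoff (Suc N) q"
  have "coeff ?q N \<noteq> 0" using N P.ideal_zero by (auto simp: coeff_poly_cutoff)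
  then have "degree ?q = N"
    by (intro antisym degree_le le_degree) (auto simp: coeff_poly_cutoff)
  with N have "lead_coeff ?q \<notin> P" by (simp add: coeff_poly_cutoff)
  moreover have "?q \<in> polys_over A" "q - ?q \<in> polys_over P"
    using assms(1) gt by (auto simp: polys_over_def coeff_poly_cutoff zero_mem P.ideal_zero)
  ultimately show ?thesis by blast
qed

text \<open>Long division by h over A/P, where each step multiplies f by the leading coefficient of
  h instead of dividing by it. Minimality of the degree of h excludes a nonzero remainder. H will be
  Q itself or Q + (b).\<close>

lemma pseudo_division:
  assumes "subring_ideal (polys_over A) H" and PH: "polys_over P \<subseteq> H"
    and h: "h \<in> H"
    and min: "\<And>f. f \<in> H \<Longrightarrow> lead_coeff f \<notin> P \<Longrightarrow> degree h \<le> degree f"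
    and f: "f \<in> H"
  shows "\<exists>m. \<exists>s \<in> polys_over A. smult (lead_coeff h ^ m) f - h * s \<in> polys_over P"
proof -
  interpret H: subring_ideal "polys_over A" H by fact
  let ?a = "lead_coeff h" and ?d = "degree h"
  have aA: "?a \<in> A" using h H.ideal_subset by (auto simp: polys_over_def)
  have "\<exists>m. \<exists>s \<in> polys_over A. smult (?a ^ m) f - h * s \<in> polys_over P"
    if "f \<in> H" "\<forall>i\<ge>n. coeff f i = 0" for n f
    using that
  proof (induction n arbitrary: f)
    case 0
    then have "f = 0" by (auto simp: poly_eq_iff)
    then show ?case by (intro exI[of _ 0] bexI[of _ 0]) (auto intro: AX.zero_mem PX.ideal_zero)
  next
    case (Suc n)
    let ?c = "coeff f n"
    have cA: "?c \<in> A" using Suc.prems H.ideal_subset by (auto simp: polys_over_def)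
    show ?case
    proof (cases "?c \<in> P")
      \<comment> \<open>The top coefficient is zero modulo P, so its monomial lies in H and can be
        removed.\<close>
      case True
      let ?m = "monom ?c n"
      have mP: "?m \<in> polys_over P" by (rule polys_over_monom[OF P.ideal_zero True])
      have "coeff (f - ?m) i = 0" if "i \<ge> n" for i
        using that Suc.prems(2) by (cases "i = n") (auto simp: coeff_monom)
      then obtain m s where s: "s \<in> polys_over A" "smult (?a ^ m) (f - ?m) - h * s \<in> polys_over P"
        using Suc.IH[of "f - ?m"] H.ideal_diff[OF Suc.prems(1)] mP PH by blast
      have "smult (?a ^ m) f - h * s = (smult (?a ^ m) (f - ?m) - h * s) + [:?a ^ m:] * ?m"
        by (simp add: smult_diff_right)
      also have "\<dots> \<in> polys_over P"
        by (intro PX.ideal_add s PX.ideal_mult const_mem power_mem aA mP)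
      finally show ?thesis using s(1) by blast
    next
      case False
      then have "?c \<noteq> 0" using P.ideal_zero by auto
      then have deg: "degree f = n"
        using Suc.prems(2) by (intro antisym degree_le le_degree) auto
      with False have dn: "?d \<le> n" using min[OF Suc.prems(1)] by simp
      let ?t = "monom ?c (n - ?d)"
      have tA: "?t \<in> polys_over A" by (rule polys_over_monom[OF zero_mem cA])
      let ?f = "smult ?a f - h * ?t"
      have fH: "?f \<in> H"
        using H.ideal_diff[OF H.ideal_mult[OF const_mem[OF aA] Suc.prems(1)] H.ideal_mult'[OF h tA]]
        by simp
      have "coeff ?f i = 0" if "i \<ge> n" for i
      proof (cases "i = n")
        case True
        then show ?thesis
          using dn by (simp add: mult.commute[of h] coeff_monom_mult)
      next
        case False
        have "coeff (h * ?t) i = 0"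
          using that False dn by (simp add: mult.commute[of h] coeff_monom_mult coeff_eq_0)
        then show ?thesis using that False Suc.prems(2) by simp
      qed
      then obtain m s where s: "s \<in> polys_over A" "smult (?a ^ m) ?f - h * s \<in> polys_over P"
        using Suc.IH[OF fH] by blast
      have "smult (?a ^ Suc m) f - h * (s + smult (?a ^ m) ?t) = smult (?a ^ m) ?f - h * s"
        by (simp add: smult_diff_right algebra_simps)
      then show ?thesis
        using s AX.add_mem[OF s(1) smult_mem[OF power_mem[OF aA] tA]] by metis
    qed
  qed
  from this[of f "Suc (degree f)"] f show ?thesis
    by (auto simp: coeff_eq_0)
qed

lemma exists_min_degree:
  assumes "H \<subseteq> polys_over A" "f \<in> H" "lead_coeff f \<notin> P"
  obtains h where "h \<in> H" "lead_coeff h \<notin> P"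
    "\<And>f. f \<in> H \<Longrightarrow> lead_coeff f \<notin> P \<Longrightarrow> degree h \<le> degree f"
  using ex_has_least_nat[of "\<lambda>f. f \<in> H \<and> lead_coeff f \<notin> P" f degree] assms by blast

text \<open>
  Modulo \<open>Q\<close>, the element \<open>b\<close> is algebraic over \<open>A\<close>, so it divides a nonzero constant. The constant
  is a member of least degree of \<open>Q + (b)\<close>: if its degree were positive, its cofactor in \<open>g\<close>
  would be a member of \<open>Q\<close> of smaller degree than \<open>g\<close>.
\<close>

lemma divides_constant:
  assumes g: "g \<in> Q" "lead_coeff g \<notin> P"
    and gmin: "\<And>f. f \<in> Q \<Longrightarrow> lead_coeff f \<notin> P \<Longrightarrow> degree g \<le> degree f"
    and b: "b \<in> polys_over A" "b \<notin> Q"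
  shows "\<exists>c \<in> A - P. \<exists>s \<in> polys_over A. [:c:] - b * s \<in> Q"
proof -
  define H where "H = {f \<in> polys_over A. \<exists>s \<in> polys_over A. f - b * s \<in> Q}"
  have QH: "Q \<subseteq> H" using Q.ideal_subset AX.zero_mem by (auto simp: H_def intro!: bexI[of _ 0])
  have "subring_ideal (polys_over A) H"
  proof
    show "H \<subseteq> polys_over A" by (auto simp: H_def)
    show "0 \<in> H" using QH Q.ideal_zero by blast
  next
    fix x y assume "x \<in> H" "y \<in> H"
    then obtain s t where *: "x \<in> polys_over A" "y \<in> polys_over A" "s \<in> polys_over A"
      "t \<in> polys_over A" "x - b * s \<in> Q" "y - b * t \<in> Q" by (auto simp: H_def)
    then have "x + y - b * (s + t) \<in> Q"
      using Q.ideal_add[of "x - b * s" "y - b * t"] by (simp add: algebra_simps)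
    then show "x + y \<in> H" using * AX.add_mem by (auto simp: H_def)
  next
    fix x y assume "x \<in> polys_over A" "y \<in> H"
    then obtain s where *: "x \<in> polys_over A" "y \<in> polys_over A" "s \<in> polys_over A"
      "y - b * s \<in> Q" by (auto simp: H_def)
    then have "x * y - b * (x * s) \<in> Q"
      using Q.ideal_mult[of x "y - b * s"] by (simp add: algebra_simps)
    then show "x * y \<in> H" using * AX.mult_mem by (auto simp: H_def)
  qed
  then interpret H: subring_ideal "polys_over A" H .
  have PH: "polys_over P \<subseteq> H" using QH polys_over_P_subset by blast
  obtain h where h: "h \<in> H" "lead_coeff h \<notin> P"
    and hmin: "\<And>f. f \<in> H \<Longrightarrow> lead_coeff f \<notin> P \<Longrightarrow> degree h \<le> degree f"
    using exists_min_degree[of H g] H.ideal_subset g QH by blast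
  let ?a = "lead_coeff h"
  have hA: "h \<in> polys_over A" and aA: "?a \<in> A"
    using h H.ideal_subset by (auto simp: polys_over_def)
  have pow: "?a ^ m \<in> A" "?a ^ m \<notin> P" for m
    using power_mem[OF aA] P.prime_power[OF aA] h(2) by auto
  have powQ: "[:?a ^ m:] \<notin> Q" for m
    using pow by (auto simp: contraction_def)
  have bH: "b \<in> H"
    using b AX.one_mem by (auto simp: H_def Q.ideal_zero intro!: bexI[of _ 1])
  obtain m s where s: "s \<in> polys_over A" "smult (?a ^ m) b - h * s \<in> polys_over P"
    using pseudo_division[OF H.subring_ideal_axioms PH h(1) hmin bH] by blast
  have gH: "g \<in> H" using g QH by blast
  obtain l t where t: "t \<in> polys_over A" "smult (?a ^ l) g - h * t \<in> polys_over P"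
    using pseudo_division[OF H.subring_ideal_axioms PH h(1) hmin gH] by blast
  \<comment> \<open>If h were in Q, pseudo-division would put a power of \<open>?a\<close> times b
    into the prime Q.\<close>
  have "h \<notin> Q"
  proof
    assume "h \<in> Q"
    then have "(smult (?a ^ m) b - h * s) + h * s \<in> Q"
      using s polys_over_P_subset by (intro Q.ideal_add Q.ideal_mult') auto
    then have "[:?a ^ m:] * b \<in> Q" by simp
    then show False using Q.prime_mult[OF const_mem[OF pow(1)] b(1)] powQ b(2) by blast
  qed
  moreover have "h * t \<in> Q"
  proof -
    have "[:?a ^ l:] * g - (smult (?a ^ l) g - h * t) \<in> Q"
      using subsetD[OF polys_over_P_subset t(2)] g(1)
      by (rule Q.ideal_diff[OF Q.ideal_mult[OF const_mem[OF pow(1)]], rotated])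
    then show ?thesis by simp
  qed
  ultimately have tQ: "t \<in> Q" using Q.prime_mult[OF hA t(1)] by blast
  \<comment> \<open>Modulo P, t is the cofactor of h in \<open>?a ^ l\<close> times g, and this
    multiple of g is nonzero since its coefficient at \<open>degree g\<close> is.\<close>
  have "t \<notin> polys_over P"
  proof
    assume "t \<in> polys_over P"
    then have "(smult (?a ^ l) g - h * t) + h * t \<in> polys_over P"
      using t hA by (intro PX.ideal_add PX.ideal_mult) auto
    then have "?a ^ l * lead_coeff g \<in> P" by (simp add: polys_over_def)
    then show False
      using P.prime_mult[OF pow(1)] pow(2) g Q.ideal_subset by (auto simp: polys_over_def)
  qed
  then obtain t' where t': "t' \<in> polys_over A" "lead_coeff t' \<notin> P" "t - t' \<in> polys_over P"
    using exists_truncation[OF t(1)] by blast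
  have "t - (t - t') \<in> Q" by (intro Q.ideal_diff tQ subsetD[OF polys_over_P_subset t'(3)])
  then have le: "degree g \<le> degree t'" using gmin t'(2) by simp
  have "(smult (?a ^ l) g - h * t) + h * (t - t') \<in> polys_over P"
    by (intro PX.ideal_add PX.ideal_mult t t' hA)
  then have "smult (?a ^ l) g - h * t' \<in> polys_over P" by (simp add: algebra_simps)
  \<comment> \<open>Compare coefficients at \<open>degree h + degree t'\<close>: the product of the
    leading coefficients of h and t' is not in P, so g has a nonzero coefficient there.\<close>
  then have "?a ^ l * coeff g (degree h + degree t') - ?a * lead_coeff t' \<in> P"
    by (metis coeff_diff coeff_mem coeff_mult_degree_sum coeff_smult)
  moreover have "?a * lead_coeff t' \<notin> P"
    using P.prime_mult[OF aA coeff_mem[OF t'(1)]] h(2) t'(2) by blast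
  ultimately have "coeff g (degree h + degree t') \<noteq> 0"
    using P.ideal_uminus by fastforce
  then have "degree h + degree t' \<le> degree g" by (rule le_degree)
  with le have "degree h = 0" by simp
  then have "h = [:?a:]" by (metis degree_0_id)
  moreover obtain s where "s \<in> polys_over A" "h - b * s \<in> Q"
    using h(1) by (auto simp: H_def)
  ultimately show ?thesis
    using h(2) aA by (metis DiffI)
qed

end

text \<open>Homomorphisms on a whole type, without carriers: evaluation at a point is defined for
  polynomials in all variables at once.\<close>

locale total_ring_hom =
  fixes \<phi> :: "'a::comm_ring_1 \<Rightarrow> 'b::comm_ring_1"
  assumes hom_one: "\<phi> 1 = 1"
    and hom_add: "\<phi> (x + y) = \<phi> x + \<phi> y"
    and hom_mult: "\<phi> (x * y) = \<phi> x * \<phi> y"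
begin

lemma hom_zero: "\<phi> 0 = 0"
  using hom_add[of 0 0] by simp

lemma hom_diff: "\<phi> (x - y) = \<phi> x - \<phi> y"
  using hom_add[of "x - y" y] by simp

lemma hom_power: "\<phi> (x ^ m) = \<phi> x ^ m"
  by (induction m) (simp_all add: hom_one hom_mult)

lemma hom_sum: "\<phi> (sum f I) = (\<Sum>i\<in>I. \<phi> (f i))"
  by (induction I rule: infinite_finite_induct) (simp_all add: hom_zero hom_add)

lemma hom_poly: "\<phi> (poly q x) = poly (map_poly \<phi> q) (\<phi> x)"
  by (induction q) (simp_all add: hom_zero hom_add hom_mult map_poly_pCons)

lemma map_poly_diff: "map_poly \<phi> (p - q) = map_poly \<phi> p - map_poly \<phi> q"
  by (rule poly_eqI) (simp add: coeff_map_poly hom_zero hom_diff)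

lemma map_poly_mult: "map_poly \<phi> (p * q) = map_poly \<phi> p * map_poly \<phi> q"
  by (rule poly_eqI) (simp add: coeff_map_poly hom_zero coeff_mult hom_sum hom_mult)

lemma map_poly_smult: "map_poly \<phi> (smult a p) = smult (\<phi> a) (map_poly \<phi> p)"
  by (rule poly_eqI) (simp add: coeff_map_poly hom_zero hom_mult)

end

text \<open>At a root x of X p - 1 one has x p(x) = 1; the root exists because this polynomial has
  the positive degree of X p.\<close>

lemma exists_nonroot:
  fixes p :: "'b::alg_closed_field poly"
  assumes "p \<noteq> 0"
  shows "\<exists>x. poly p x \<noteq> 0"
proof -
  have "degree (pCons 0 p - 1) = degree (pCons 0 p)"
    using assms degree_add_eq_left[of "- 1" "pCons 0 p"] by simp
  then have "degree (pCons 0 p - 1) > 0" using assms by simp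
  then obtain x where "poly (pCons 0 p - 1) x = 0"
    using alg_closed_imp_poly_has_root by blast
  then show ?thesis by (intro exI[of _ x]) auto
qed

context poly_prime
begin

text \<open>A homomorphism from A/P to an algebraically closed field extends to A[X]/Q, with b still
  nonzero, once a single c outside P survives. Choosing c before \<open>\<phi>\<close> lets the
  Nullstellensatz recurse on c. If Q = P[X], the new element is transcendental and any non-root w of
  the image of b works; otherwise it is algebraic, and w is a root of the image of a member of Q of
  least degree modulo P.\<close>

lemma extend_hom:
  assumes b: "b \<in> polys_over A" "b \<notin> Q"
  shows "\<exists>c \<in> A - P. \<forall>\<phi> :: 'a \<Rightarrow> 'b::alg_closed_field.
     total_ring_hom \<phi> \<longrightarrow> (\<forall>a \<in> P. \<phi> a = 0) \<longrightarrow> \<phi> c \<noteq> 0 \<longrightarrow>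
     (\<exists>w. (\<forall>q \<in> Q. poly (map_poly \<phi> q) w = 0) \<and> poly (map_poly \<phi> b) w \<noteq> 0)"
proof (cases "Q \<subseteq> polys_over P")
  case True
  obtain i where i: "coeff b i \<notin> P"
    using b polys_over_P_subset by (auto simp: polys_over_def)
  show ?thesis
  proof (intro bexI[of _ "coeff b i"] allI impI)
    show "coeff b i \<in> A - P" using i b by (simp add: polys_over_def)
    fix \<phi> :: "'a \<Rightarrow> 'b"
    assume "total_ring_hom \<phi>" and zero: "\<forall>a \<in> P. \<phi> a = 0" and nz: "\<phi> (coeff b i) \<noteq> 0"
    then interpret total_ring_hom \<phi> by simp
    have "coeff (map_poly \<phi> b) i \<noteq> 0" using nz by (simp add: coeff_map_poly hom_zero)
    then have "map_poly \<phi> b \<noteq> 0" by auto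
    moreover have "map_poly \<phi> q = 0" if "q \<in> Q" for q
      using that True zero by (intro poly_eqI) (auto simp: coeff_map_poly hom_zero polys_over_def)
    ultimately show "\<exists>w. (\<forall>q \<in> Q. poly (map_poly \<phi> q) w = 0) \<and> poly (map_poly \<phi> b) w \<noteq> 0"
      using exists_nonroot[of "map_poly \<phi> b"] by auto
  qed
next
  case False
  then obtain q where q: "q \<in> Q" "q \<notin> polys_over P" by blast
  then obtain q' where q': "q' \<in> polys_over A" "lead_coeff q' \<notin> P" "q - q' \<in> polys_over P"
    using exists_truncation Q.ideal_subset by blast
  have "q - (q - q') \<in> Q"
    by (intro Q.ideal_diff q(1) subsetD[OF polys_over_P_subset q'(3)])
  then have "q' \<in> Q" by simp
  then obtain g where g: "g \<in> Q" "lead_coeff g \<notin> P"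
    and gmin: "\<And>f. f \<in> Q \<Longrightarrow> lead_coeff f \<notin> P \<Longrightarrow> degree g \<le> degree f"
    using exists_min_degree[OF Q.ideal_subset _ q'(2)] by blast
  obtain c s where c: "c \<in> A" "c \<notin> P" and s: "s \<in> polys_over A" "[:c:] - b * s \<in> Q"
    using divides_constant[OF g gmin b] by blast
  let ?a = "lead_coeff g"
  have aA: "?a \<in> A" using g Q.ideal_subset by (auto simp: polys_over_def)
  have "degree g \<noteq> 0"
  proof
    assume "degree g = 0"
    then have "g = [:?a:]" by (metis degree_0_id)
    with g aA show False by (simp add: contraction_def)
  qed
  \<comment> \<open>The factor \<open>?a\<close> keeps the degree of g under \<open>\<phi>\<close>,
    so that g gets a root, and can be cancelled after pseudo-division; the factor c forces b, which
    divides it modulo Q, to be nonzero at that root.\<close>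
  show ?thesis
  proof (intro bexI[of _ "?a * c"] allI impI)
    show "?a * c \<in> A - P" using P.prime_mult[OF aA c(1)] mult_mem[OF aA c(1)] c(2) g(2) by blast
    fix \<phi> :: "'a \<Rightarrow> 'b"
    assume "total_ring_hom \<phi>" and zero: "\<forall>a \<in> P. \<phi> a = 0" and nz: "\<phi> (?a * c) \<noteq> 0"
    then interpret total_ring_hom \<phi> by simp
    have nz': "\<phi> ?a \<noteq> 0" "\<phi> c \<noteq> 0" using nz by (auto simp: hom_mult)
    have "degree (map_poly \<phi> g) > 0"
      using nz' \<open>degree g \<noteq> 0\<close> le_degree[of "map_poly \<phi> g" "degree g"]
      by (simp add: coeff_map_poly hom_zero)
    then obtain w where w: "poly (map_poly \<phi> g) w = 0"
      using alg_closed_imp_poly_has_root by blast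
    have Qw: "poly (map_poly \<phi> q) w = 0" if q: "q \<in> Q" for q
    proof -
      obtain m t where t: "smult (?a ^ m) q - g * t \<in> polys_over P"
        using pseudo_division[OF Q.subring_ideal_axioms polys_over_P_subset g(1) gmin q] by blast
      then have "map_poly \<phi> (smult (?a ^ m) q - g * t) = 0"
        using zero by (intro poly_eqI) (auto simp: coeff_map_poly hom_zero polys_over_def)
      then have "smult (\<phi> ?a ^ m) (map_poly \<phi> q) = map_poly \<phi> g * map_poly \<phi> t"
        by (simp add: map_poly_diff map_poly_mult map_poly_smult hom_power)
      then have "\<phi> ?a ^ m * poly (map_poly \<phi> q) w = 0"
        using w by (metis mult_zero_left poly_mult poly_smult)
      then show ?thesis using nz' by simp
    qed
    moreover have "poly (map_poly \<phi> ([:c:] - b * s)) w = 0" by (rule Qw[OF s(2)])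
    then have "\<phi> c = poly (map_poly \<phi> b) w * poly (map_poly \<phi> s) w"
      by (simp add: map_poly_diff map_poly_mult map_poly_pCons hom_zero)
    then have "poly (map_poly \<phi> b) w \<noteq> 0" using nz' by auto
    ultimately show "\<exists>w. (\<forall>q \<in> Q. poly (map_poly \<phi> q) w = 0) \<and> poly (map_poly \<phi> b) w \<noteq> 0"
      by blast
  qed
qed

end

section \<open>The Nullstellensatz\<close>

lemma lookup_mpoly_to_ac [simp]:
  "Poly_Mapping.lookup (mpoly_to_ac f) m = to_ac (Poly_Mapping.lookup f m)"
  by (simp add: mpoly_to_ac_def Poly_Mapping.map.rep_eq when_def)

lemma keys_mpoly_to_ac [simp]: "Poly_Mapping.keys (mpoly_to_ac f) = Poly_Mapping.keys f"
  by (auto simp: in_keys_iff)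

lemma mpoly_to_ac_mem: "mpoly_to_ac f \<in> mpolys n \<longleftrightarrow> f \<in> mpolys n"
  by (simp add: mpolys_def)

lemma mpoly_to_ac_add: "mpoly_to_ac (f + g) = mpoly_to_ac f + mpoly_to_ac g"
  by (rule poly_mapping_eqI) (simp add: lookup_add)

lemma mpoly_to_ac_single: "mpoly_to_ac (Poly_Mapping.single m c) = Poly_Mapping.single m (to_ac c)"
  by (rule poly_mapping_eqI) (simp add: lookup_single when_def)

lemma mpoly_to_ac_one: "mpoly_to_ac 1 = 1"
  using mpoly_to_ac_single[of 0 1] by simp

lemma mpoly_to_ac_sum: "mpoly_to_ac (sum f I) = (\<Sum>i\<in>I. mpoly_to_ac (f i))"
proof -
  have "mpoly_to_ac 0 = 0" by (rule poly_mapping_eqI) simp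
  then show ?thesis
    by (induction I rule: infinite_finite_induct) (simp_all add: mpoly_to_ac_add)
qed

lemma mpoly_to_ac_mult: "mpoly_to_ac (f * g) = mpoly_to_ac f * mpoly_to_ac g"
proof -
  let ?F = "\<lambda>f m. Poly_Mapping.single m (Poly_Mapping.lookup f m)"
  have "mpoly_to_ac (f * g) = mpoly_to_ac
      ((\<Sum>m\<in>Poly_Mapping.keys f. ?F f m) * (\<Sum>l\<in>Poly_Mapping.keys g. ?F g l))"
    using mpoly_eq_sum_single[of f] mpoly_eq_sum_single[of g] by simp
  also have "\<dots> = mpoly_to_ac (\<Sum>m\<in>Poly_Mapping.keys f. ?F f m) *
      mpoly_to_ac (\<Sum>l\<in>Poly_Mapping.keys g. ?F g l)"
    by (simp only: sum_product mpoly_to_ac_sum mult_single mpoly_to_ac_single to_ac_mult)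
  also have "\<dots> = mpoly_to_ac f * mpoly_to_ac g"
    using mpoly_eq_sum_single[of f] mpoly_eq_sum_single[of g] by simp
  finally show ?thesis .
qed

text \<open>With the point as first argument, \<open>ac_eval p\<close> is the homomorphism from k[X]
  to k^alg over k determined by p.\<close>

definition ac_eval :: "(nat \<Rightarrow> 'k::field alg_closure) \<Rightarrow> 'k mpoly \<Rightarrow> 'k alg_closure" where
  "ac_eval p f = mpoly_eval (mpoly_to_ac f) p"

lemma total_ring_hom_ac_eval: "total_ring_hom (ac_eval p)"
  by unfold_locales (simp_all add: ac_eval_def mpoly_to_ac_one mpoly_to_ac_add mpoly_to_ac_mult)

lemma ac_eval_zero [simp]: "ac_eval p 0 = 0"
  by (rule total_ring_hom.hom_zero[OF total_ring_hom_ac_eval])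

lemma mpoly_eval_cong:
  assumes "f \<in> mpolys n" "\<And>i. i < n \<Longrightarrow> p i = q i"
  shows "mpoly_eval f p = mpoly_eval f q"
  unfolding mpoly_eval_def
  by (intro sum.cong refl arg_cong2[where f = "(*)"] prod.cong arg_cong2[where f = "(^)"])
    (use assms in \<open>auto simp: mpolys_def\<close>)

lemma ac_eval_cong:
  assumes "f \<in> mpolys n" "\<And>i. i < n \<Longrightarrow> p i = q i"
  shows "ac_eval p f = ac_eval q f"
  unfolding ac_eval_def using assms by (intro mpoly_eval_cong[of _ n]) (simp_all add: mpoly_to_ac_mem)

lemma mpoly_eval_diff [simp]: "mpoly_eval (f - g) p = mpoly_eval f p - mpoly_eval g p"
  using mpoly_eval_add[of f "- g" p] by simp

lemma mpolys_diff: "f \<in> mpolys n \<Longrightarrow> g \<in> mpolys n \<Longrightarrow> f - g \<in> mpolys n"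
  for f g :: "'k::ab_group_add mpoly"
  using mpolys_add[OF _ mpolys_uminus, of f n g] by simp

interpretation mpolys: comm_subring "mpolys n :: 'k::comm_ring_1 mpoly set" for n
  by unfold_locales (auto intro: mpolys_diff mpolys_times)

lemma mpolys_mono: "i \<le> j \<Longrightarrow> mpolys i \<subseteq> mpolys j"
  by (fastforce simp: mpolys_def)

definition mvar :: "nat \<Rightarrow> 'k::comm_ring_1 mpoly" where
  "mvar i = Poly_Mapping.single (Poly_Mapping.single i 1) 1"

lemma mvar_mem: "i < n \<Longrightarrow> mvar i \<in> mpolys n"
  by (simp add: mvar_def mpolys_def)

lemma mvar_power: "mvar i ^ e = Poly_Mapping.single (Poly_Mapping.single i e) 1"
  by (induction e) (simp_all add: mvar_def mult_single single_add[symmetric])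

lemma ac_eval_mvar: "ac_eval p (mvar i) = p i"
  by (simp add: ac_eval_def mvar_def mpoly_to_ac_single mpoly_eval_single)

lemma poly_mem_mpolys:
  fixes q :: "'k::comm_ring_1 mpoly poly"
  assumes "q \<in> polys_over (mpolys n)" "x \<in> mpolys n"
  shows "poly q x \<in> mpolys n"
  unfolding poly_altdef
  by (intro mpolys.sum_mem mpolys.mult_mem mpolys.power_mem coeff_mem assms)

text \<open>Collecting powers of the last variable: evaluation at \<open>mvar i\<close> is onto.
  Primes are pulled back along it in the Nullstellensatz, and linear relations are pushed forward
  along it in the basis theorem.\<close>

lemma mpolys_Suc_as_poly:
  fixes f :: "'k::comm_ring_1 mpoly"
  assumes "f \<in> mpolys (Suc i)"
  shows "\<exists>q \<in> polys_over (mpolys i). poly q (mvar i) = f"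
proof -
  let ?q = "\<lambda>m. monom (Poly_Mapping.single (m - Poly_Mapping.single i (Poly_Mapping.lookup m i))
      (Poly_Mapping.lookup f m)) (Poly_Mapping.lookup m i)"
  have q: "?q m \<in> polys_over (mpolys i) \<and>
      poly (?q m) (mvar i) = Poly_Mapping.single m (Poly_Mapping.lookup f m)"
    if m: "m \<in> Poly_Mapping.keys f" for m
  proof
    let ?m' = "m - Poly_Mapping.single i (Poly_Mapping.lookup m i)"
    have "Poly_Mapping.keys m \<subseteq> {..<Suc i}" using m assms by (auto simp: mpolys_def)
    then have "Poly_Mapping.keys ?m' \<subseteq> {..<i}"
      by (auto simp: in_keys_iff lookup_minus lookup_single when_def subset_iff less_Suc_eq)
    then show "?q m \<in> polys_over (mpolys i)"
      by (intro polys_over_monom) (auto simp: mpolys_def)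
    have "?m' + Poly_Mapping.single i (Poly_Mapping.lookup m i) = m"
      by (rule poly_mapping_eqI) (simp add: lookup_add lookup_minus lookup_single when_def)
    then show "poly (?q m) (mvar i) = Poly_Mapping.single m (Poly_Mapping.lookup f m)"
      by (simp add: poly_monom mvar_power mult_single)
  qed
  interpret AX: comm_subring "polys_over (mpolys i :: 'k mpoly set)"
    by (rule mpolys.comm_subring_polys_over)
  have "poly (\<Sum>m\<in>Poly_Mapping.keys f. ?q m) (mvar i) = f"
    using q mpoly_eq_sum_single[of f] by (simp add: poly_sum)
  moreover have "(\<Sum>m\<in>Poly_Mapping.keys f. ?q m) \<in> polys_over (mpolys i)"
    using q by (intro AX.sum_mem) blast
  ultimately show ?thesis by blast
qed

lemma mpolys_0_const:
  assumes "f \<in> mpolys 0"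
  shows "\<exists>c. f = Poly_Mapping.single 0 c"
proof -
  have "Poly_Mapping.keys f \<subseteq> {0}" using assms by (auto simp: mpolys_def)
  then have "f = Poly_Mapping.single 0 (Poly_Mapping.lookup f 0)"
    by (intro poly_mapping_eqI) (auto simp: lookup_single when_def in_keys_iff)
  then show ?thesis by blast
qed

text \<open>Induction on the number i of variables, with P fixed: the point is built coordinate by
  coordinate, and the c from \<open>extend_hom\<close> takes the place of b one level down.\<close>

lemma nullstellensatz_prime:
  fixes P :: "'k::field mpoly set"
  assumes "subring_prime (mpolys n) P" "i \<le> n" "b \<in> mpolys i" "b \<notin> P"
  shows "\<exists>p. (\<forall>f \<in> P \<inter> mpolys i. ac_eval p f = 0) \<and> ac_eval p b \<noteq> 0"
  using assms(2-4)
proof (induction i arbitrary: b)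
  interpret P: subring_prime "mpolys n" P by fact
  case 0
  \<comment> \<open>P contains no nonzero constant, since such constants are units.\<close>
  have zero: "f = 0" if f: "f \<in> P" "f \<in> mpolys 0" for f
  proof (rule ccontr)
    assume "f \<noteq> 0"
    obtain c where c: "f = Poly_Mapping.single 0 c" using mpolys_0_const f by blast
    have "Poly_Mapping.single 0 (inverse c) * f \<in> P"
      using f by (intro P.ideal_mult) (auto simp: mpolys_def)
    then show False
      using \<open>f \<noteq> 0\<close> P.prime_one by (cases "c = 0") (simp_all add: c mult_single)
  qed
  obtain c where c: "b = Poly_Mapping.single 0 c" using mpolys_0_const 0 by blast
  with 0 P.ideal_zero have "c \<noteq> 0" by auto
  then have "ac_eval undefined b \<noteq> 0"
    by (simp add: c ac_eval_def mpoly_to_ac_single mpoly_eval_single)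
  then show ?case using zero by (metis IntD1 IntD2 ac_eval_zero)
next
  interpret P: subring_prime "mpolys n" P by fact
  case (Suc i)
  let ?A = "mpolys i :: 'k mpoly set" and ?x = "mvar i :: 'k mpoly"
  \<comment> \<open>The inverse image of P under substituting \<open>?x\<close> for the polynomial
    variable; its contraction is P \<inter> k[X_0, ..., X_{i-1}].\<close>
  define Q where "Q = {q \<in> polys_over ?A. poly q ?x \<in> P}"
  interpret AX: comm_subring "polys_over ?A" by (rule mpolys.comm_subring_polys_over)
  have mem: "poly q ?x \<in> mpolys n" if "q \<in> polys_over ?A" for q
  proof (rule poly_mem_mpolys)
    show "q \<in> polys_over (mpolys n)"
      using that mpolys_mono[of i n] Suc.prems(1) by (auto simp: polys_over_def)
  qed (use Suc.prems(1) in \<open>simp add: mvar_mem\<close>)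
  interpret poly_prime ?A Q
  proof unfold_locales
    show "Q \<subseteq> polys_over ?A" by (auto simp: Q_def)
  next
    fix a b assume "a \<in> polys_over ?A" "b \<in> polys_over ?A" "a * b \<in> Q"
    then show "a \<in> Q \<or> b \<in> Q" using P.prime_mult[OF mem mem] by (auto simp: Q_def)
  qed (auto simp: Q_def AX.zero_mem P.ideal_zero P.prime_one
      intro: AX.add_mem AX.mult_mem P.ideal_add P.ideal_mult mem)
  have contr: "contraction = P \<inter> mpolys i"
    using const_mem unfolding contraction_def by (auto simp: Q_def)
  obtain q where q: "q \<in> polys_over ?A" "poly q ?x = b"
    using mpolys_Suc_as_poly[OF Suc.prems(2)] by blast
  then have "q \<notin> Q" using Suc.prems by (auto simp: Q_def)
  then obtain c where c: "c \<in> mpolys i" "c \<notin> contraction" and ext: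
    "\<And>\<phi> :: 'k mpoly \<Rightarrow> 'k alg_closure. total_ring_hom \<phi> \<Longrightarrow> (\<forall>a \<in> contraction. \<phi> a = 0) \<Longrightarrow>
       \<phi> c \<noteq> 0 \<Longrightarrow> \<exists>w. (\<forall>q \<in> Q. poly (map_poly \<phi> q) w = 0) \<and> poly (map_poly \<phi> q) w \<noteq> 0"
    using extend_hom[OF q(1), where 'b = "'k alg_closure"] by blast
  obtain p where p: "\<forall>f \<in> P \<inter> mpolys i. ac_eval p f = 0" "ac_eval p c \<noteq> 0"
    using Suc.IH[of c] Suc.prems(1) c contr by auto
  then obtain w where w: "\<forall>q \<in> Q. poly (map_poly (ac_eval p) q) w = 0"
      "poly (map_poly (ac_eval p) q) w \<noteq> 0"
    using ext[OF total_ring_hom_ac_eval] contr by metis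
  \<comment> \<open>Polynomials in \<open>mpolys i\<close> do not involve coordinate i, so their
    values survive the update.\<close>
  let ?p = "p(i := w)"
  have ev: "ac_eval ?p (poly r ?x) = poly (map_poly (ac_eval p) r) w" if "r \<in> polys_over ?A" for r
  proof -
    have "map_poly (ac_eval ?p) r = map_poly (ac_eval p) r"
      using that ac_eval_cong[of _ i ?p p]
      by (intro poly_eqI) (simp add: coeff_map_poly polys_over_def)
    then show ?thesis
      by (simp add: total_ring_hom.hom_poly[OF total_ring_hom_ac_eval] ac_eval_mvar)
  qed
  have "ac_eval ?p f = 0" if f: "f \<in> P" "f \<in> mpolys (Suc i)" for f
  proof -
    obtain r where r: "r \<in> polys_over ?A" "poly r ?x = f"
      using mpolys_Suc_as_poly[OF f(2)] by blast
    then have "r \<in> Q" using f by (simp add: Q_def)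
    then show ?thesis using ev[OF r(1)] r w by simp
  qed
  moreover have "ac_eval ?p b \<noteq> 0" using ev[OF q(1)] q w by simp
  ultimately show ?case by blast
qed

section \<open>From primes to all proper ideals\<close>

lemma (in cring) exists_maximalideal:
  assumes "ideal I R" "\<one> \<notin> I"
  shows "\<exists>M. maximalideal M R \<and> I \<subseteq> M"
proof -
  define S where "S = {J. ideal J R \<and> I \<subseteq> J \<and> \<one> \<notin> J}"
  have "\<exists>M \<in> S. \<forall>J \<in> S. M \<subseteq> J \<longrightarrow> J = M"
  proof (rule subset_Zorn_nonempty)
    show "S \<noteq> {}" using assms by (auto simp: S_def)
    fix C assume C: "C \<noteq> {}" "subset.chain S C"
    then have "subset.chain {J. ideal J R} C" by (auto simp: pred_on.chain_def S_def)
    from chain_Union_is_ideal[OF this] C show "\<Union>C \<in> S"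
      by (auto simp: pred_on.chain_def S_def)
  qed
  then obtain M where M: "ideal M R" "I \<subseteq> M" "\<one> \<notin> M" and
    max: "\<And>J. ideal J R \<Longrightarrow> I \<subseteq> J \<Longrightarrow> \<one> \<notin> J \<Longrightarrow> M \<subseteq> J \<Longrightarrow> J = M"
    by (auto simp: S_def)
  have "maximalideal M R"
  proof (rule maximalidealI[OF M(1)])
    show "carrier R \<noteq> M" using M(3) by auto
    fix J assume "ideal J R" "M \<subseteq> J" "J \<subseteq> carrier R"
    then show "J = M \<or> J = carrier R"
      using max[of J] M(2) ideal.one_imp_carrier[of J R] by blast
  qed
  with M(2) show ?thesis by blast
qed

lemma subring_prime_of_maximalideal:
  assumes "maximalideal M (mpoly_ring n :: 'k::comm_ring_1 mpoly ring)"
  shows "subring_prime (mpolys n) M"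
proof -
  interpret cring "mpoly_ring n :: 'k mpoly ring" by (rule cring_mpoly_ring)
  interpret M: primeideal M "mpoly_ring n :: 'k mpoly ring"
    by (rule maximalideal_prime[OF assms])
  show ?thesis
  proof
    show "M \<subseteq> mpolys n" using M.a_subset by simp
    show "0 \<in> M" using M.zero_closed by simp
    show "1 \<notin> M" using M.one_imp_carrier M.I_notcarr by auto
  next
    fix a b assume "a \<in> M" "b \<in> M"
    then show "a + b \<in> M" using M.a_closed[of a b] by simp
  next
    fix a b :: "'k mpoly" assume "a \<in> mpolys n" "b \<in> M"
    then show "a * b \<in> M" using M.I_l_closed[of b a] by simp
  next
    fix a b :: "'k mpoly" assume "a \<in> mpolys n" "b \<in> mpolys n" "a * b \<in> M"
    then show "a \<in> M \<or> b \<in> M" using M.I_prime[of a b] by simp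
  qed
qed

text \<open>A maximal ideal above J is prime and omits 1, so \<open>nullstellensatz_prime\<close>
  applies with b = 1.\<close>

theorem weak_nullstellensatz:
  fixes J :: "'k::field mpoly set"
  assumes "ideal J (mpoly_ring n)" "1 \<notin> J"
  shows "\<exists>p. \<forall>f \<in> J. ac_eval p f = 0"
proof -
  interpret cring "mpoly_ring n :: 'k mpoly ring" by (rule cring_mpoly_ring)
  obtain M where M: "maximalideal M (mpoly_ring n)" "J \<subseteq> M"
    using exists_maximalideal[OF assms(1)] assms(2) by auto
  interpret M: subring_prime "mpolys n" M
    by (rule subring_prime_of_maximalideal[OF M(1)])
  obtain p where "\<forall>f \<in> M \<inter> mpolys n. ac_eval p f = 0"
    using nullstellensatz_prime[OF M.subring_prime_axioms order_refl mpolys_one M.prime_one]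
    by blast
  then show ?thesis using M(2) M.ideal_subset by blast
qed

section \<open>Units of the coordinate ring\<close>

lemma ideal_mpoly_ringI:
  fixes J :: "'k::comm_ring_1 mpoly set"
  assumes "J \<subseteq> mpolys n" "0 \<in> J" "\<And>f g. f \<in> J \<Longrightarrow> g \<in> J \<Longrightarrow> f + g \<in> J"
    and mult: "\<And>f g. f \<in> mpolys n \<Longrightarrow> g \<in> J \<Longrightarrow> f * g \<in> J"
  shows "ideal J (mpoly_ring n)"
proof -
  interpret cring "mpoly_ring n :: 'k mpoly ring" by (rule cring_mpoly_ring)
  have uminus: "- f \<in> J" if "f \<in> J" for f
    using mult[of "- 1" f] that mpolys_uminus[OF mpolys_one, of n] by simp
  have inv: "\<ominus>\<^bsub>mpoly_ring n\<^esub> f = - f" if "f \<in> mpolys n" for f :: "'k mpoly"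
    using that by (intro minus_equality) (auto intro: mpolys_uminus)
  show ?thesis
  proof (rule idealI)
    show "subgroup J (add_monoid (mpoly_ring n))"
      using assms uminus by (intro add.subgroupI) (auto simp: inv a_inv_def[symmetric])
    fix f g :: "'k mpoly" assume "f \<in> J" "g \<in> carrier (mpoly_ring n)"
    then show "g \<otimes>\<^bsub>mpoly_ring n\<^esub> f \<in> J" "f \<otimes>\<^bsub>mpoly_ring n\<^esub> g \<in> J"
      using mult[of g f] by (simp_all add: mult.commute)
  qed (rule ring_axioms)
qed

section \<open>The Zariski closure over k^alg, by linear algebra over k\<close>

interpretation ac: vector_space "\<lambda>c (x :: 'k::field alg_closure). to_ac c * x"
  by unfold_locales (simp_all add: algebra_simps)

lemma point_to_ac_in_affine_space: "point_to_ac n p \<in> affine_space n"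
  by (simp add: point_to_ac_def affine_space_def)

text \<open>Presents the value at a point of k^n as a k-linear combination of the coefficients of g,
  the form to which coordinates in a basis apply.\<close>

lemma mpoly_eval_point_to_ac:
  assumes "g \<in> mpolys n"
  shows "mpoly_eval g (point_to_ac n v) = (\<Sum>m\<in>Poly_Mapping.keys g.
    to_ac (\<Prod>i\<in>Poly_Mapping.keys m. v i ^ Poly_Mapping.lookup m i) * Poly_Mapping.lookup g m)"
  unfolding mpoly_eval_def to_ac_prod
  by (subst mult.commute, intro sum.cong refl arg_cong2[where f = "(*)"] prod.cong)
    (use assms in \<open>auto simp: mpolys_def point_to_ac_def subset_iff\<close>)

lemma ac_eval_point_to_ac:
  assumes "f \<in> mpolys n"
  shows "ac_eval (point_to_ac n v) f = to_ac (mpoly_eval f v)"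
proof -
  have "mpoly_to_ac f \<in> mpolys n" using assms by (simp add: mpoly_to_ac_mem)
  then show ?thesis
    by (simp add: ac_eval_def mpoly_eval_point_to_ac mpoly_eval_def[of f] to_ac_sum mult.commute)
qed

text \<open>
  A polynomial over the algebraic closure vanishes on \<open>V\<close> iff its components with respect to a
  basis of the algebraic closure over \<open>k\<close> do, and these lie in \<open>k[X]\<close>.
\<close>

lemma in_ac_closureI:
  fixes V :: "(nat \<Rightarrow> 'k::field) set"
  assumes p: "p \<in> affine_space n" and zero: "\<And>f. f \<in> vanishing_ideal n V \<Longrightarrow> ac_eval p f = 0"
  shows "p \<in> ac_closure n V"
proof -
  define B :: "'k alg_closure set" where "B = ac.extend_basis {}"
  have B: "ac.independent B" "ac.span B = UNIV"
    unfolding B_def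
    by (rule ac.independent_extend_basis ac.span_extend_basis; simp add: ac.independent_empty)+
  let ?r = "ac.representation B"
  have r0: "?r 0 b = 0" for b by (simp add: ac.representation_zero)
  have "mpoly_eval g p = 0"
    if g: "g \<in> mpolys n" and gV: "\<And>v. v \<in> V \<Longrightarrow> mpoly_eval g (point_to_ac n v) = 0" for g
  proof -
    let ?K = "Poly_Mapping.keys g"
    \<comment> \<open>The component of g at the basis element b, a polynomial over k. Taking
      coordinates is k-linear, so its values on V are coordinates of values of g, hence
      zero.\<close>
    define c where "c b = Poly_Mapping.map (\<lambda>x. ?r x b) g" for b
    have lookup_c: "Poly_Mapping.lookup (c b) m = ?r (Poly_Mapping.lookup g m) b" for b m
      by (simp add: c_def Poly_Mapping.map.rep_eq when_def r0)
    have keys_c: "Poly_Mapping.keys (c b) \<subseteq> ?K" for b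
      by (auto simp: in_keys_iff lookup_c r0)
    have c_mem: "c b \<in> mpolys n" for b
      using g keys_c[of b] by (auto simp: mpolys_def)
    have "mpoly_eval (c b) v = ?r (mpoly_eval g (point_to_ac n v)) b" for b v
    proof -
      have "?r (mpoly_eval g (point_to_ac n v)) b = (\<Sum>m\<in>?K.
          (\<Prod>i\<in>Poly_Mapping.keys m. v i ^ Poly_Mapping.lookup m i) * ?r (Poly_Mapping.lookup g m) b)"
        by (simp add: mpoly_eval_point_to_ac[OF g]
            ac.representation_sum[OF B(1)] ac.representation_scale[OF B(1)] B(2))
      then show ?thesis
        by (simp add: mpoly_eval_superset[OF _ keys_c] lookup_c mult.commute)
    qed
    then have "c b \<in> vanishing_ideal n V" for b
      using c_mem gV by (simp add: vanishing_ideal_def r0)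
    then have c0: "ac_eval p (c b) = 0" for b by (rule zero)
    let ?t = "\<lambda>m. \<Prod>i\<in>Poly_Mapping.keys m. p i ^ Poly_Mapping.lookup m i"
    \<comment> \<open>The finitely many basis elements that occur in the coefficients of g.\<close>
    define F where "F = (\<Union>m\<in>?K. {b. ?r (Poly_Mapping.lookup g m) b \<noteq> 0})"
    have F: "finite F" by (simp add: F_def ac.finite_representation)
    have "Poly_Mapping.lookup g m = (\<Sum>b\<in>F. to_ac (?r (Poly_Mapping.lookup g m) b) * b)"
      if "m \<in> ?K" for m
    proof -
      have "(\<Sum>b\<in>F. to_ac (?r (Poly_Mapping.lookup g m) b) * b) =
          (\<Sum>b | ?r (Poly_Mapping.lookup g m) b \<noteq> 0. to_ac (?r (Poly_Mapping.lookup g m) b) * b)"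
        by (rule sum.mono_neutral_right[OF F]) (use that in \<open>auto simp: F_def\<close>)
      also have "\<dots> = Poly_Mapping.lookup g m"
        by (rule ac.sum_nonzero_representation_eq[OF B(1)]) (simp add: B(2))
      finally show ?thesis by simp
    qed
    then have "mpoly_eval g p = (\<Sum>m\<in>?K. (\<Sum>b\<in>F. to_ac (?r (Poly_Mapping.lookup g m) b) * b) * ?t m)"
      unfolding mpoly_eval_def by (intro sum.cong) auto
    also have "\<dots> = (\<Sum>b\<in>F. b * (\<Sum>m\<in>?K. to_ac (?r (Poly_Mapping.lookup g m) b) * ?t m))"
      unfolding sum_distrib_right sum_distrib_left
      by (subst sum.swap) (simp add: ac_simps)
    also have "\<dots> = (\<Sum>b\<in>F. b * ac_eval p (c b))"
      by (simp add: ac_eval_def mpoly_eval_superset[of ?K] keys_c lookup_c)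
    finally show ?thesis by (simp add: c0)
  qed
  moreover have "algebraic_set n (ac_closure n V)"
    unfolding ac_closure_def closedin_zariski[symmetric] by (rule closedin_closure_of)
  then obtain Z where Z: "Z \<subseteq> mpolys n"
    "ac_closure n V = {q \<in> affine_space n. \<forall>f \<in> Z. mpoly_eval f q = 0}"
    unfolding algebraic_set_def by blast
  moreover have "point_to_ac n ` V \<subseteq> ac_closure n V"
    unfolding ac_closure_def
    by (rule closure_of_subset) (auto simp: point_to_ac_in_affine_space)
  ultimately show ?thesis using p by blast
qed

lemma ac_eval_ac_closure:
  assumes f: "f \<in> vanishing_ideal n V" and p: "p \<in> ac_closure n V"
  shows "ac_eval p f = 0"
proof -
  have fn: "f \<in> mpolys n" using f by (simp add: vanishing_ideal_def)
  let ?Z = "{q \<in> affine_space n. \<forall>g \<in> {mpoly_to_ac f}. mpoly_eval g q = 0}"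
  have "algebraic_set n ?Z"
    unfolding algebraic_set_def
    by (rule exI[of _ "{mpoly_to_ac f}"]) (simp add: mpoly_to_ac_mem fn)
  moreover have "point_to_ac n ` V \<subseteq> ?Z"
    using f ac_eval_point_to_ac[OF fn]
    by (auto simp: point_to_ac_in_affine_space vanishing_ideal_def ac_eval_def)
  ultimately have "ac_closure n V \<subseteq> ?Z"
    unfolding ac_closure_def by (intro closure_of_minimal) (simp_all add: closedin_zariski)
  then show ?thesis using p by (auto simp: ac_eval_def)
qed

text \<open>Expressed by values, so that it applies to a part U of V as well without changing the
  quotient ring.\<close>

definition invertible_on :: "nat \<Rightarrow> (nat \<Rightarrow> 'k::comm_ring_1) set \<Rightarrow> 'k mpoly \<Rightarrow> bool" where
  "invertible_on n V f \<longleftrightarrow> (\<exists>g \<in> mpolys n. \<forall>v \<in> V. mpoly_eval f v * mpoly_eval g v = 1)"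

text \<open>A relation f g = 1 on V persists on W. Conversely, zeros of I(V) over k^alg lie in W, so
  if f has no zero there, then I(V) + (f) has no zero at all and contains 1.\<close>

lemma invertible_on_iff_no_zero:
  fixes V :: "(nat \<Rightarrow> 'k::field) set"
  assumes f: "f \<in> mpolys n"
  shows "invertible_on n V f \<longleftrightarrow> \<not> (\<exists>p \<in> ac_closure n V. mpoly_eval (mpoly_to_ac f) p = 0)"
proof
  assume "invertible_on n V f"
  then obtain g where g: "g \<in> mpolys n" "\<forall>v \<in> V. mpoly_eval f v * mpoly_eval g v = 1"
    by (auto simp: invertible_on_def)
  then have h: "1 - f * g \<in> vanishing_ideal n V"
    using f by (auto simp: vanishing_ideal_def intro: mpolys_diff mpolys_times)
  have "ac_eval p f * ac_eval p g = 1" if "p \<in> ac_closure n V" for p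
  proof -
    interpret total_ring_hom "ac_eval p" by (rule total_ring_hom_ac_eval)
    show ?thesis using ac_eval_ac_closure[OF h that] by (simp add: hom_diff hom_mult hom_one)
  qed
  then show "\<not> (\<exists>p \<in> ac_closure n V. mpoly_eval (mpoly_to_ac f) p = 0)"
    by (metis ac_eval_def mult_zero_left zero_neq_one)
next
  assume nozero: "\<not> (\<exists>p \<in> ac_closure n V. mpoly_eval (mpoly_to_ac f) p = 0)"
  \<comment> \<open>This is I(V) + (f), described by values on V.\<close>
  define J where "J = {x \<in> mpolys n. \<exists>g \<in> mpolys n. \<forall>v \<in> V. mpoly_eval x v = mpoly_eval f v * mpoly_eval g v}"
  have "ideal J (mpoly_ring n)"
  proof (rule ideal_mpoly_ringI)
    fix x y assume "x \<in> J" "y \<in> J"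
    then obtain g h where "x \<in> mpolys n" "y \<in> mpolys n" "g \<in> mpolys n" "h \<in> mpolys n"
      "\<forall>v \<in> V. mpoly_eval x v = mpoly_eval f v * mpoly_eval g v"
      "\<forall>v \<in> V. mpoly_eval y v = mpoly_eval f v * mpoly_eval h v"
      by (auto simp: J_def)
    then show "x + y \<in> J"
      by (auto simp: J_def distrib_left mpolys_add intro!: bexI[of _ "g + h"])
  next
    fix x y :: "'k mpoly" assume "x \<in> mpolys n" "y \<in> J"
    then obtain g where "x \<in> mpolys n" "y \<in> mpolys n" "g \<in> mpolys n"
      "\<forall>v \<in> V. mpoly_eval y v = mpoly_eval f v * mpoly_eval g v"
      by (auto simp: J_def)
    then show "x * y \<in> J"
      by (auto simp: J_def mpolys_times intro!: bexI[of _ "x * g"])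
  qed (auto simp: J_def intro!: bexI[of _ 0])
  moreover have "\<nexists>p. \<forall>x \<in> J. ac_eval p x = 0"
  proof
    assume "\<exists>p. \<forall>x \<in> J. ac_eval p x = 0"
    then obtain p where p: "\<And>x. x \<in> J \<Longrightarrow> ac_eval p x = 0" by blast
    \<comment> \<open>The point p has arbitrary values from n on, where points of affine space are
      \<open>undefined\<close>.\<close>
    let ?p = "restrict p {..<n}"
    have p': "ac_eval ?p x = 0" if "x \<in> J" for x
      using p[OF that] that ac_eval_cong[of x n ?p p] by (auto simp: J_def)
    have "vanishing_ideal n V \<subseteq> J"
      by (auto simp: J_def vanishing_ideal_def intro!: bexI[of _ 0])
    then have "?p \<in> ac_closure n V"
      using p' by (intro in_ac_closureI) (auto simp: affine_space_def)
    moreover have "f \<in> J" using f by (auto simp: J_def intro!: bexI[of _ 1])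
    ultimately show False using nozero p' by (auto simp: ac_eval_def)
  qed
  ultimately have "1 \<in> J" using weak_nullstellensatz by blast
  then show "invertible_on n V f" by (auto simp: J_def invertible_on_def)
qed

lemma fundamental_iff:
  "fundamental n V \<longleftrightarrow>
     (\<forall>f \<in> mpolys n. invertible_on n V f \<longrightarrow> mpoly_eval f constant_on V)"
  using invertible_on_iff_no_zero unfolding fundamental_def by blast

lemma locally_fundamental_iff:
  "locally_fundamental n V \<longleftrightarrow>
     (\<forall>f \<in> mpolys n. invertible_on n V f \<longrightarrow>
        locally_constant_on_space (subtopology (zariski n) V) (mpoly_eval f))"
  using invertible_on_iff_no_zero unfolding locally_fundamental_def by blast

section \<open>The coordinate ring as a ring of functions on V\<close>

definition coord_class :: "nat \<Rightarrow> (nat \<Rightarrow> 'k::comm_ring_1) set \<Rightarrow> 'k mpoly \<Rightarrow> 'k mpoly set" where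
  "coord_class n V f = vanishing_ideal n V +>\<^bsub>mpoly_ring n\<^esub> f"

lemma coord_class_hom: "coord_class n V \<in> ring_hom (mpoly_ring n) (coordinate_ring n V)"
  unfolding coord_class_def[abs_def] coordinate_ring_def
  by (rule ideal.rcos_ring_hom[OF ideal_vanishing_ideal])

lemma carrier_coordinate_ring: "carrier (coordinate_ring n V) = coord_class n V ` mpolys n"
  by (auto simp: coordinate_ring_def FactRing_def A_RCOSETS_def' coord_class_def)

lemma coord_class_eq_iff:
  fixes V :: "(nat \<Rightarrow> 'k::comm_ring_1) set"
  assumes "f \<in> mpolys n" "g \<in> mpolys n"
  shows "coord_class n V f = coord_class n V g \<longleftrightarrow> (\<forall>v \<in> V. mpoly_eval f v = mpoly_eval g v)"
proof -
  interpret cring "mpoly_ring n :: 'k mpoly ring" by (rule cring_mpoly_ring)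
  have "\<ominus>\<^bsub>mpoly_ring n\<^esub> g = - g"
    using assms by (intro minus_equality) (auto intro: mpolys_uminus)
  then have "f \<ominus>\<^bsub>mpoly_ring n\<^esub> g = f - g" by (simp add: a_minus_def)
  then show ?thesis
    using quotient_eq_iff_same_a_r_cos[OF ideal_vanishing_ideal, of f g V] assms
    by (simp add: coord_class_def vanishing_ideal_def mpolys_diff)
qed

lemma coordinate_ring_simps:
  "f \<in> mpolys n \<Longrightarrow> g \<in> mpolys n \<Longrightarrow>
     coord_class n V f \<otimes>\<^bsub>coordinate_ring n V\<^esub> coord_class n V g = coord_class n V (f * g)"
  "f \<in> mpolys n \<Longrightarrow> g \<in> mpolys n \<Longrightarrow>
     coord_class n V f \<oplus>\<^bsub>coordinate_ring n V\<^esub> coord_class n V g = coord_class n V (f + g)"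
  "\<one>\<^bsub>coordinate_ring n V\<^esub> = coord_class n V 1"
  "\<zero>\<^bsub>coordinate_ring n V\<^esub> = coord_class n V 0"
proof -
  interpret R: cring "mpoly_ring n :: 'a mpoly ring" by (rule cring_mpoly_ring)
  interpret S: cring "coordinate_ring n V" by (rule cring_coordinate_ring)
  show "f \<in> mpolys n \<Longrightarrow> g \<in> mpolys n \<Longrightarrow>
      coord_class n V f \<otimes>\<^bsub>coordinate_ring n V\<^esub> coord_class n V g = coord_class n V (f * g)"
    "f \<in> mpolys n \<Longrightarrow> g \<in> mpolys n \<Longrightarrow>
      coord_class n V f \<oplus>\<^bsub>coordinate_ring n V\<^esub> coord_class n V g = coord_class n V (f + g)"
    "\<one>\<^bsub>coordinate_ring n V\<^esub> = coord_class n V 1"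
    using ring_hom_memE[OF coord_class_hom[of n V]] by auto
  show "\<zero>\<^bsub>coordinate_ring n V\<^esub> = coord_class n V 0"
    using ring_hom_zero[OF coord_class_hom R.ring_axioms S.ring_axioms] by simp
qed

lemma Units_coordinate_ring_iff:
  fixes V :: "(nat \<Rightarrow> 'k::comm_ring_1) set"
  assumes f: "f \<in> mpolys n"
  shows "coord_class n V f \<in> Units (coordinate_ring n V) \<longleftrightarrow> invertible_on n V f"
proof
  assume "coord_class n V f \<in> Units (coordinate_ring n V)"
  then obtain g where g: "g \<in> mpolys n"
    "coord_class n V f \<otimes>\<^bsub>coordinate_ring n V\<^esub> coord_class n V g = \<one>\<^bsub>coordinate_ring n V\<^esub>"
    by (auto simp: Units_def carrier_coordinate_ring)
  then have "coord_class n V (f * g) = coord_class n V 1"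
    using f by (simp add: coordinate_ring_simps)
  then show "invertible_on n V f"
    using f g(1) by (auto simp: coord_class_eq_iff mpolys_times invertible_on_def)
next
  assume "invertible_on n V f"
  then obtain g where g: "g \<in> mpolys n" "\<forall>v \<in> V. mpoly_eval f v * mpoly_eval g v = 1"
    by (auto simp: invertible_on_def)
  then have "coord_class n V (f * g) = coord_class n V 1" "coord_class n V (g * f) = coord_class n V 1"
    using f by (simp_all add: coord_class_eq_iff mpolys_times mult.commute)
  then show "coord_class n V f \<in> Units (coordinate_ring n V)"
    using f g(1) unfolding Units_def carrier_coordinate_ring
    by (auto simp: coordinate_ring_simps intro!: bexI[of _ g])
qed

text \<open>Classes are functions with values in a domain, so the ring is reduced.\<close>

lemma nilradical_coordinate_ring:
  fixes V :: "(nat \<Rightarrow> 'k::idom) set"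
  shows "nilradical (coordinate_ring n V) = {\<zero>\<^bsub>coordinate_ring n V\<^esub>}"
proof -
  interpret S: cring "coordinate_ring n V" by (rule cring_coordinate_ring)
  have pow: "coord_class n V f [^]\<^bsub>coordinate_ring n V\<^esub> m = coord_class n V (f ^ m)"
    if "f \<in> mpolys n" for f and m :: nat
  proof (induction m)
    case 0
    show ?case by (simp add: coordinate_ring_simps(3))
  next
    case (Suc m)
    then show ?case
      using coordinate_ring_simps(1)[of "f ^ m" n f V] that mpolys.power_mem[OF that, of m]
      by (simp add: mult.commute)
  qed
  show ?thesis
  proof (intro equalityI subsetI)
    fix x assume "x \<in> nilradical (coordinate_ring n V)"
    then obtain m :: nat where m: "x \<in> carrier (coordinate_ring n V)"
      "x [^]\<^bsub>coordinate_ring n V\<^esub> m = coord_class n V 0"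
      by (auto simp: nilradical_def coordinate_ring_simps(4))
    then obtain f where f: "f \<in> mpolys n" "x = coord_class n V f"
      unfolding carrier_coordinate_ring by blast
    with m pow have "coord_class n V (f ^ m) = coord_class n V 0" by simp
    note f = f this
    interpret ev: total_ring_hom "\<lambda>f. mpoly_eval f v" for v :: "nat \<Rightarrow> 'k"
      by unfold_locales simp_all
    have "\<forall>v \<in> V. mpoly_eval f v = 0"
      using f(3) by (simp add: coord_class_eq_iff mpolys.power_mem f(1) ev.hom_power)
    then show "x \<in> {\<zero>\<^bsub>coordinate_ring n V\<^esub>}"
      by (simp add: f(1,2) coordinate_ring_simps(4) coord_class_eq_iff)
  next
    fix x assume "x \<in> {\<zero>\<^bsub>coordinate_ring n V\<^esub>}"
    then show "x \<in> nilradical (coordinate_ring n V)"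
      using S.nat_pow_eone[OF S.zero_closed] S.zero_closed
      unfolding nilradical_def by blast
  qed
qed

definition mconst :: "'k::comm_ring_1 \<Rightarrow> 'k mpoly" where
  "mconst c = Poly_Mapping.single 0 c"

lemma mconst_mem [simp]: "mconst c \<in> mpolys n"
  by (simp add: mconst_def mpolys_def)

lemma mpoly_eval_mconst [simp]: "mpoly_eval (mconst c) p = c"
  by (simp add: mconst_def mpoly_eval_single)

lemma invertible_on_mconst: "c \<noteq> 0 \<Longrightarrow> invertible_on n V (mconst c)" for c :: "'k::field"
  by (auto simp: invertible_on_def intro!: bexI[of _ "mconst (inverse c)"])

text \<open>If all units are constant functions, the sum of two units is a constant, hence zero or a
  unit.\<close>

lemma unit_additive_coordinate_ring_iff:
  fixes V :: "(nat \<Rightarrow> 'k::field) set"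
  shows "unit_additive (coordinate_ring n V) \<longleftrightarrow>
    (\<forall>f \<in> mpolys n. invertible_on n V f \<longrightarrow> mpoly_eval f constant_on V)"
    (is "?L \<longleftrightarrow> ?R")
proof -
  \<comment> \<open>Passage to representatives; nilpotent means vanishing on V because R is
    reduced.\<close>
  have L: "?L \<longleftrightarrow> (\<forall>f \<in> mpolys n. \<forall>g \<in> mpolys n. invertible_on n V f \<longrightarrow> invertible_on n V g \<longrightarrow>
      invertible_on n V (f + g) \<or> (\<forall>v \<in> V. mpoly_eval (f + g) v = 0))"
  proof -
    define F where "F = {f \<in> mpolys n. invertible_on n V f}"
    have U: "Units (coordinate_ring n V) = coord_class n V ` F"
      using Units_coordinate_ring_iff[of _ n V]
      by (auto simp: F_def carrier_coordinate_ring Units_def[of "coordinate_ring n V"])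
    have "(\<forall>u \<in> Units (coordinate_ring n V). \<forall>v \<in> Units (coordinate_ring n V). T u v) \<longleftrightarrow>
        (\<forall>f \<in> F. \<forall>g \<in> F. T (coord_class n V f) (coord_class n V g))" for T
      unfolding U by simp
    then have "?L \<longleftrightarrow> (\<forall>f \<in> F. \<forall>g \<in> F. coord_class n V (f + g) \<in> Units (coordinate_ring n V) \<or>
        coord_class n V (f + g) = coord_class n V 0)"
      unfolding unit_additive_def nilradical_coordinate_ring
      by (simp add: cring_coordinate_ring coordinate_ring_simps F_def)
    also have "\<dots> \<longleftrightarrow> (\<forall>f \<in> F. \<forall>g \<in> F. invertible_on n V (f + g) \<or> (\<forall>v \<in> V. mpoly_eval (f + g) v = 0))"
      by (intro ball_cong refl)
        (simp add: F_def mpolys_add Units_coordinate_ring_iff coord_class_eq_iff)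
    finally show ?thesis unfolding F_def by blast
  qed
  show ?thesis
  proof
    assume ?L
    show ?R
    proof (intro ballI impI)
      fix f :: "'k mpoly" assume f: "f \<in> mpolys n" "invertible_on n V f"
      show "mpoly_eval f constant_on V"
      proof (cases "V = {}")
        case False
        then obtain v where v: "v \<in> V" by blast
        let ?c = "mpoly_eval f v"
        have "?c \<noteq> 0" using f(2) v by (force simp: invertible_on_def)
        then have "invertible_on n V (mconst (- ?c))" by (intro invertible_on_mconst) simp
        then have "invertible_on n V (f + mconst (- ?c)) \<or>
            (\<forall>w \<in> V. mpoly_eval (f + mconst (- ?c)) w = 0)"
          using \<open>?L\<close>[unfolded L, rule_format, of f "mconst (- ?c)"] f mconst_mem by blast
        moreover have "\<not> invertible_on n V (f + mconst (- ?c))"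
          using v by (force simp: invertible_on_def)
        ultimately show ?thesis unfolding constant_on_def by auto
      qed (simp add: constant_on_def)
    qed
  next
    assume R: ?R
    show ?L
      unfolding L
    proof (intro ballI impI)
      fix f g :: "'k mpoly"
      assume "f \<in> mpolys n" "g \<in> mpolys n" "invertible_on n V f" "invertible_on n V g"
      then have "mpoly_eval f constant_on V" "mpoly_eval g constant_on V" using R by blast+
      then obtain a b where "\<forall>v \<in> V. mpoly_eval f v = a" "\<forall>v \<in> V. mpoly_eval g v = b"
        by (auto simp: constant_on_def)
      then show "invertible_on n V (f + g) \<or> (\<forall>v \<in> V. mpoly_eval (f + g) v = 0)"
        using invertible_on_mconst[of "a + b" n V]
        by (cases "a + b = 0") (auto simp: invertible_on_def)
    qed
  qed
qed

section \<open>Hilbert's basis theorem\<close>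

definition lin_span :: "'a::comm_ring_1 set \<Rightarrow> (nat \<Rightarrow> 'a) \<Rightarrow> nat \<Rightarrow> 'a set" where
  "lin_span A f N = {\<Sum>j<N. c j * f j | c. \<forall>j. c j \<in> A}"

lemma lin_spanI: "(\<And>j. c j \<in> A) \<Longrightarrow> a = (\<Sum>j<N. c j * f j) \<Longrightarrow> a \<in> lin_span A f N"
  by (auto simp: lin_span_def)

lemma lin_spanE:
  assumes "a \<in> lin_span A f N"
  obtains c where "\<forall>j. c j \<in> A" "a = (\<Sum>j<N. c j * f j)"
  using assms by (auto simp: lin_span_def)

text \<open>
  The ascending chain condition for the finitely generated ideals \<open>lin_span A f N\<close> of \<open>A\<close>.
\<close>

definition noetherian_subring :: "'a::comm_ring_1 set \<Rightarrow> bool" where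
  "noetherian_subring A \<longleftrightarrow> (\<forall>f. (\<forall>j. f j \<in> A) \<longrightarrow> (\<exists>N. f N \<in> lin_span A f N))"

context comm_subring
begin

lemma subring_ideal_lin_span:
  assumes "\<And>j. j < N \<Longrightarrow> f j \<in> A"
  shows "subring_ideal A (lin_span A f N)"
proof
  show "lin_span A f N \<subseteq> A"
    using assms by (auto simp: lin_span_def intro!: sum_mem mult_mem)
  show "0 \<in> lin_span A f N"
    by (rule lin_spanI[of "\<lambda>_. 0"]) (simp_all add: zero_mem)
next
  fix a b assume ab: "a \<in> lin_span A f N" "b \<in> lin_span A f N"
  obtain c where "\<forall>j. c j \<in> A" "a = (\<Sum>j<N. c j * f j)"
    using ab(1) by (rule lin_spanE)
  moreover obtain d where "\<forall>j. d j \<in> A" "b = (\<Sum>j<N. d j * f j)"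
    using ab(2) by (rule lin_spanE)
  ultimately show "a + b \<in> lin_span A f N"
    by (intro lin_spanI[of "\<lambda>j. c j + d j"]) (simp_all add: sum.distrib distrib_right add_mem)
next
  fix a b assume "a \<in> A" and b: "b \<in> lin_span A f N"
  obtain c where "\<forall>j. c j \<in> A" "b = (\<Sum>j<N. c j * f j)"
    using b by (rule lin_spanE)
  then show "a * b \<in> lin_span A f N"
    using \<open>a \<in> A\<close>
    by (intro lin_spanI[of "\<lambda>j. a * c j"]) (simp_all add: sum_distrib_left mult.assoc mult_mem)
qed

lemma lin_span_gen:
  assumes "j < N"
  shows "f j \<in> lin_span A f N"
proof (rule lin_spanI[of "\<lambda>i. if i = j then 1 else 0"])
  have "(\<Sum>i<N. (if i = j then 1 else 0) * f i) = (\<Sum>i<N. if i = j then f i else 0)"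
    by (rule sum.cong) auto
  then show "f j = (\<Sum>i<N. (if i = j then 1 else 0) * f i)" using assms by simp
qed (simp add: one_mem zero_mem)

lemma lin_span_mono:
  assumes "M \<le> N"
  shows "lin_span A f M \<subseteq> lin_span A f N"
proof
  fix a assume "a \<in> lin_span A f M"
  then obtain c where c: "\<forall>j. c j \<in> A" "a = (\<Sum>j<M. c j * f j)" by (rule lin_spanE)
  then have "a = (\<Sum>j<N. (if j < M then c j else 0) * f j)"
    using assms by (auto intro!: sum.mono_neutral_cong_left split: if_splits)
  then show "a \<in> lin_span A f N"
    using c(1) zero_mem by (intro lin_spanI) auto
qed

lemma lin_span_subset:
  assumes "subring_ideal A J" "\<And>j. j < N \<Longrightarrow> f j \<in> J"
  shows "lin_span A f N \<subseteq> J"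
proof -
  interpret subring_ideal A J by fact
  show ?thesis using assms(2) by (auto simp: lin_span_def intro!: ideal_sum ideal_mult)
qed

text \<open>Hilbert's argument in the union I of the finite spans: let g_N have least degree in I
  outside the span of its predecessors; if its leading coefficient depends on theirs, an element of
  smaller degree outside that span appears.\<close>

theorem noetherian_polys_over:
  assumes "noetherian_subring A"
  shows "noetherian_subring (polys_over A)"
proof (rule ccontr)
  interpret AX: comm_subring "polys_over A" by (rule comm_subring_polys_over)
  assume "\<not> noetherian_subring (polys_over A)"
  then obtain f where f: "\<And>j. f j \<in> polys_over A" "\<And>N. f N \<notin> lin_span (polys_over A) f N"
    by (auto simp: noetherian_subring_def)
  define I where "I = (\<Union>N. lin_span (polys_over A) f N)"
  have span_ideal: "subring_ideal (polys_over A) (lin_span (polys_over A) f N)" for N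
    by (intro AX.subring_ideal_lin_span f)
  \<comment> \<open>The spans increase, so finitely many members of their union lie in a common
    one.\<close>
  have I_bound: "\<exists>M. \<forall>j<N. g j \<in> lin_span (polys_over A) f M" if "\<And>j. j < N \<Longrightarrow> g j \<in> I"
    for g :: "nat \<Rightarrow> 'a poly" and N
    using that
  proof (induction N)
    case (Suc N)
    then obtain M where M: "\<forall>j<N. g j \<in> lin_span (polys_over A) f M" by auto
    obtain M' where "g N \<in> lin_span (polys_over A) f M'" using Suc.prems[of N] by (auto simp: I_def)
    then have "\<forall>j<Suc N. g j \<in> lin_span (polys_over A) f (max M M')"
      using M AX.lin_span_mono[of M "max M M'" f] AX.lin_span_mono[of M' "max M M'" f]
      by (auto simp: less_Suc_eq)
    then show ?case by blast
  qed auto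
  have "subring_ideal (polys_over A) I"
  proof
    show "I \<subseteq> polys_over A" "0 \<in> I"
      using subring_ideal.ideal_subset[OF span_ideal] subring_ideal.ideal_zero[OF span_ideal]
      by (auto simp: I_def)
  next
    fix a b assume "a \<in> I" "b \<in> I"
    then have *: "(if j = 0 then a else b) \<in> I" for j :: nat by simp
    \<comment> \<open>Two elements are read as a sequence of length 2 to reuse
      \<open>I_bound\<close>.\<close>
    obtain M where M: "\<forall>j<2::nat. (if j = 0 then a else b) \<in> lin_span (polys_over A) f M"
      using exE[OF I_bound[of 2 "\<lambda>j. if j = 0 then a else b", OF *]] .
    show "a + b \<in> I"
      using M[rule_format, of 0] M[rule_format, of 1] subring_ideal.ideal_add[OF span_ideal] by (auto simp: I_def)
  next
    fix a b assume "a \<in> polys_over A" "b \<in> I"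
    then show "a * b \<in> I" using subring_ideal.ideal_mult[OF span_ideal] by (auto simp: I_def)
  qed
  then interpret I: subring_ideal "polys_over A" I .
  let ?P = "\<lambda>g N r. r \<in> I - lin_span (polys_over A) g N \<and>
      (\<forall>q \<in> I - lin_span (polys_over A) g N. degree r \<le> degree q)"
  have "\<exists>g. \<forall>N. ?P g N (g N)"
  proof (rule dependent_wellorder_choice)
    fix g h :: "nat \<Rightarrow> 'a poly" and N r
    assume "\<And>j. j < N \<Longrightarrow> g j = h j"
    then have "lin_span (polys_over A) g N = lin_span (polys_over A) h N" by (simp add: lin_span_def)
    then show "?P g N r = ?P h N r" by simp
  next
    fix N and g :: "nat \<Rightarrow> 'a poly"
    assume "\<And>j. j < N \<Longrightarrow> ?P g j (g j)"
    then obtain M where "\<forall>j<N. g j \<in> lin_span (polys_over A) f M" using I_bound[of N g] by blast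
    then have "lin_span (polys_over A) g N \<subseteq> lin_span (polys_over A) f M"
      using AX.lin_span_subset[OF span_ideal] by blast
    \<comment> \<open>The g_j chosen so far lie in one finite span of f, and f itself leaves that
      span, so a candidate remains.\<close>
    then have "f M \<notin> lin_span (polys_over A) g N" using f(2) by blast
    moreover have "f M \<in> I" using AX.lin_span_gen[of M "Suc M" f] by (auto simp: I_def)
    ultimately show "\<exists>r. ?P g N r"
      using ex_has_least_nat[of "\<lambda>q. q \<in> I - lin_span (polys_over A) g N" "f M" degree] by blast
  qed
  then obtain g where g: "\<And>N. ?P g N (g N)" by blast
  have gA: "g j \<in> polys_over A" for j using g[of j] I.ideal_subset by blast
  have "\<forall>j. lead_coeff (g j) \<in> A" using gA coeff_mem by blast
  then obtain N where "lead_coeff (g N) \<in> lin_span A (\<lambda>j. lead_coeff (g j)) N"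
    using assms[unfolded noetherian_subring_def, rule_format, of "\<lambda>j. lead_coeff (g j)"] by blast
  then obtain c where c: "\<forall>j. c j \<in> A" "lead_coeff (g N) = (\<Sum>j<N. c j * lead_coeff (g j))"
    by (auto simp: lin_span_def)
  let ?d = "\<lambda>j. degree (g j)"
  \<comment> \<open>At stage j the later g_N was a candidate too, so degrees do not
    decrease.\<close>
  have dle: "?d j \<le> ?d N" if "j < N" for j
    using g[of j] g[of N] AX.lin_span_mono[of j N g] that by auto
  \<comment> \<open>The monomials shift each g_j up to the degree of g_N, so that s and g_N have the
    same coefficient there.\<close>
  define s where "s = (\<Sum>j<N. monom (c j) (?d N - ?d j) * g j)"
  have s_span: "s \<in> lin_span (polys_over A) g N"
    using c(1) zero_mem
    unfolding s_def by (intro lin_spanI[OF _ refl] polys_over_monom) auto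
  have span: "subring_ideal (polys_over A) (lin_span (polys_over A) g N)"
    by (intro AX.subring_ideal_lin_span gA)
  have "lin_span (polys_over A) g N \<subseteq> I"
    using g by (intro AX.lin_span_subset I.subring_ideal_axioms) blast
  then have hI: "g N - s \<in> I" using s_span g[of N] by (intro I.ideal_diff) auto
  have hspan: "g N - s \<notin> lin_span (polys_over A) g N"
    using subring_ideal.ideal_add[OF span _ s_span, of "g N - s"] g[of N] by auto
  have "coeff (g N - s) (?d N) = 0"
    using c(2) dle by (auto simp: s_def coeff_sum coeff_monom_mult intro!: sum.cong)
  moreover have "degree (g N - s) \<le> ?d N"
  proof (rule degree_le, intro allI impI)
    fix i assume "?d N < i"
    moreover have "coeff (monom (c j) (?d N - ?d j) * g j) i = 0" if "j < N" for j
      using \<open>?d N < i\<close> dle[OF that] coeff_eq_0[of "g j" "i - (?d N - ?d j)"]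
      by (auto simp: coeff_monom_mult)
    ultimately show "coeff (g N - s) i = 0" by (simp add: s_def coeff_sum coeff_eq_0)
  qed
  moreover have "g N - s \<noteq> 0" using hspan subring_ideal.ideal_zero[OF span] by auto
  ultimately have "degree (g N - s) < ?d N"
    by (metis le_neq_implies_less leading_coeff_0_iff)
  then show False using g[of N] hI hspan by (meson DiffI not_le)
qed

end

text \<open>Over a field, f 0 is zero, an empty sum, or divides f 1. With one more variable, the
  sequence is lifted along evaluation at \<open>mvar n\<close> and the resulting relation is mapped
  back.\<close>

theorem hilbert_basis: "noetherian_subring (mpolys n :: 'k::field mpoly set)"
proof (induction n)
  case 0
  show ?case
    unfolding noetherian_subring_def
  proof (intro allI impI)
    fix f :: "nat \<Rightarrow> 'k mpoly" assume f: "\<forall>j. f j \<in> mpolys 0"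
    show "\<exists>N. f N \<in> lin_span (mpolys 0) f N"
    proof (cases "f 0 = 0")
      case True
      then have "f 0 \<in> lin_span (mpolys 0) f 0"
        by (intro lin_spanI[of "\<lambda>_. 0"]) auto
      then show ?thesis by blast
    next
      case False
      obtain a b where ab: "f 0 = Poly_Mapping.single 0 a" "f 1 = Poly_Mapping.single 0 b"
        using mpolys_0_const f by metis
      with False have "f 1 = Poly_Mapping.single 0 (b / a) * f 0"
        by (auto simp: mult_single)
      then have "f 1 \<in> lin_span (mpolys 0) f 1"
        by (intro lin_spanI[of "\<lambda>_. Poly_Mapping.single 0 (b / a)"]) (auto simp: mpolys_def)
      then show ?thesis by blast
    qed
  qed
next
  case (Suc n)
  show ?case
    unfolding noetherian_subring_def
  proof (intro allI impI)
    fix f :: "nat \<Rightarrow> 'k mpoly" assume f: "\<forall>j. f j \<in> mpolys (Suc n)"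
    then have "\<forall>j. \<exists>q. q \<in> polys_over (mpolys n) \<and> poly q (mvar n) = f j"
      using mpolys_Suc_as_poly by blast
    then obtain q where q: "\<And>j. q j \<in> polys_over (mpolys n)" "\<And>j. poly (q j) (mvar n) = f j"
      by metis
    obtain N where "q N \<in> lin_span (polys_over (mpolys n)) q N"
      using mpolys.noetherian_polys_over[OF Suc] q(1) unfolding noetherian_subring_def by blast
    then obtain c where c: "\<forall>j. c j \<in> polys_over (mpolys n)" "q N = (\<Sum>j<N. c j * q j)"
      by (auto simp: lin_span_def)
    have "f N = poly (\<Sum>j<N. c j * q j) (mvar n)" using q(2)[of N] c(2) by simp
    then have "f N = (\<Sum>j<N. poly (c j) (mvar n) * f j)"
      by (simp add: poly_sum q(2))
    moreover have "poly (c j) (mvar n) \<in> mpolys (Suc n)" for j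
      using c(1) mpolys_mono[of n "Suc n"]
      by (intro poly_mem_mpolys mvar_mem) (auto simp: polys_over_def)
    ultimately show "\<exists>N. f N \<in> lin_span (mpolys (Suc n)) f N"
      by (intro exI[of _ N] lin_spanI)
  qed
qed

text \<open>The Noetherian property in terms of points: some f_N is a combination of its
  predecessors, and these all vanish at p_N.\<close>

lemma no_separated_sequence:
  fixes f :: "nat \<Rightarrow> 'k::field mpoly"
  assumes "\<And>i. f i \<in> mpolys n" "\<And>i. mpoly_eval (f i) (p i) \<noteq> 0"
    and "\<And>i j. i < j \<Longrightarrow> mpoly_eval (f i) (p j) = 0"
  shows False
proof -
  obtain N where "f N \<in> lin_span (mpolys n) f N"
    using hilbert_basis[of n] assms(1) unfolding noetherian_subring_def by blast
  then obtain c where "f N = (\<Sum>j<N. c j * f j)" by (auto simp: lin_span_def)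
  then have "mpoly_eval (f N) (p N) = 0" using assms(3) by (simp add: mpoly_eval_sum)
  then show False using assms(2) by blast
qed

section \<open>Indecomposable parts of an algebraic set\<close>

text \<open>Otherwise choose points p_i with distinct values. A neighbourhood of p_i on which
  \<open>\<phi>\<close> is constant misses every other p_j, so an equation of its complement
  separates p_i from them, against \<open>no_separated_sequence\<close>.\<close>

lemma locally_constant_finite_image:
  fixes V :: "(nat \<Rightarrow> 'k::field) set"
  assumes V: "V \<subseteq> affine_space n"
    and lc: "locally_constant_on_space (subtopology (zariski n) V) \<phi>"
  shows "finite (\<phi> ` V)"
proof (rule ccontr)
  assume "infinite (\<phi> ` V)"
  then obtain c :: "nat \<Rightarrow> _" where c: "inj c" "range c \<subseteq> \<phi> ` V"
    using infinite_countable_subset by blast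
  then have "\<forall>i. \<exists>p. p \<in> V \<and> \<phi> p = c i" by (metis imageE rangeI subsetD)
  then obtain p where p: "\<And>i. p i \<in> V" "\<And>i. \<phi> (p i) = c i" by metis
  have "\<exists>f. f \<in> mpolys n \<and> mpoly_eval f (p i) \<noteq> 0 \<and> (\<forall>j. j \<noteq> i \<longrightarrow> mpoly_eval f (p j) = 0)" for i
  proof -
    have "p i \<in> topspace (subtopology (zariski n) V)" using p V by auto
    then obtain U where U: "openin (subtopology (zariski n) V) U" "p i \<in> U" "\<phi> constant_on U"
      using lc unfolding locally_constant_on_space_def by blast
    then obtain T where T: "openin (zariski n) T" "U = T \<inter> V"
      by (auto simp: openin_subtopology)
    obtain Z where Z: "Z \<subseteq> mpolys n" "affine_space n - T = {q \<in> affine_space n. \<forall>f \<in> Z. mpoly_eval f q = 0}"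
      using T(1) by (auto simp: openin_zariski algebraic_set_def)
    have "p i \<notin> affine_space n - T" using U(2) T(2) by simp
    then obtain f where f: "f \<in> Z" "mpoly_eval f (p i) \<noteq> 0" using Z(2) p V by blast
    have "mpoly_eval f (p j) = 0" if "j \<noteq> i" for j
    proof -
      have "\<phi> (p j) \<noteq> \<phi> (p i)" using that c(1) p(2) by (simp add: inj_eq)
      then have "p j \<notin> T" using U(2,3) T(2) p(1)[of j] by (auto simp: constant_on_def)
      then have "p j \<in> affine_space n - T" using p(1) V by blast
      then show ?thesis using Z(2) f(1) by blast
    qed
    then show ?thesis using f Z(1) by blast
  qed
  then obtain f where "\<And>i. f i \<in> mpolys n" "\<And>i. mpoly_eval (f i) (p i) \<noteq> 0"
    "\<And>i j. j \<noteq> i \<Longrightarrow> mpoly_eval (f i) (p j) = 0" by metis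
  then show False using no_separated_sequence[of f n p] by auto
qed

section \<open>Idempotents of R as subsets of V\<close>

definition polynomial_indicator ::
    "nat \<Rightarrow> (nat \<Rightarrow> 'k::comm_ring_1) set \<Rightarrow> (nat \<Rightarrow> 'k) set \<Rightarrow> 'k mpoly \<Rightarrow> bool" where
  "polynomial_indicator n V U e \<longleftrightarrow>
     e \<in> mpolys n \<and> (\<forall>v \<in> V. mpoly_eval e v = (if v \<in> U then 1 else 0))"

definition detachable :: "nat \<Rightarrow> (nat \<Rightarrow> 'k::comm_ring_1) set \<Rightarrow> (nat \<Rightarrow> 'k) set \<Rightarrow> bool" where
  "detachable n V U \<longleftrightarrow> U \<subseteq> V \<and> (\<exists>e. polynomial_indicator n V U e)"

lemma detachable_self: "detachable n V V"
  by (auto simp: detachable_def polynomial_indicator_def intro!: exI[of _ 1])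

lemma detachable_Diff:
  assumes "detachable n V U" "detachable n V U'" "U' \<subseteq> U"
  shows "detachable n V (U - U')"
proof -
  obtain e e' where "polynomial_indicator n V U e" "polynomial_indicator n V U' e'"
    using assms by (auto simp: detachable_def)
  then have "polynomial_indicator n V (U - U') (e - e')"
    using assms(3) by (auto simp: polynomial_indicator_def mpolys_diff)
  then show ?thesis using assms by (auto simp: detachable_def)
qed

definition indecomposable :: "nat \<Rightarrow> (nat \<Rightarrow> 'k::comm_ring_1) set \<Rightarrow> (nat \<Rightarrow> 'k) set \<Rightarrow> bool" where
  "indecomposable n V U \<longleftrightarrow> detachable n V U \<and> (\<forall>U'. detachable n V U' \<longrightarrow> U' \<subseteq> U \<longrightarrow> U' = {} \<or> U' = U)"

text \<open>In an infinite descent the differences of consecutive parts are disjoint and have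
  polynomial indicators, so points chosen in them form a separated sequence.\<close>

lemma wf_detachable:
  fixes V :: "(nat \<Rightarrow> 'k::field) set"
  shows "wf {(U', U). detachable n V U' \<and> detachable n V U \<and> U' \<subset> U}"
  unfolding wf_iff_no_infinite_down_chain
proof
  assume "\<exists>U. \<forall>i. (U (Suc i), U i) \<in> {(U', U). detachable n V U' \<and> detachable n V U \<and> U' \<subset> U}"
  then obtain U where "\<forall>i. detachable n V (U (Suc i)) \<and> detachable n V (U i) \<and> U (Suc i) \<subset> U i"
    by auto
  then have U: "\<And>i. detachable n V (U i)" "\<And>i. U (Suc i) \<subset> U i" by blast+
  have anti: "U j \<subseteq> U i" if "i \<le> j" for i j
    using lift_Suc_antimono_le[of U i j] U(2) that by blast
  have "\<exists>e. polynomial_indicator n V (U i - U (Suc i)) e" for i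
    using detachable_Diff[OF U(1)[of i] U(1)[of "Suc i"]] U(2)[of i] by (auto simp: detachable_def)
  then obtain e where e: "\<And>i. polynomial_indicator n V (U i - U (Suc i)) (e i)" by metis
  have "\<forall>i. \<exists>p. p \<in> U i - U (Suc i)" using U(2) by blast
  then obtain p where p: "\<And>i. p i \<in> U i - U (Suc i)" by metis
  have pV: "p i \<in> V" for i using p[of i] U(1)[of i] by (auto simp: detachable_def)
  have later: "p j \<in> U (Suc i)" if "i < j" for i j
    using p[of j] anti[of "Suc i" j] that by auto
  show False
  proof (rule no_separated_sequence)
    show "e i \<in> mpolys n" "mpoly_eval (e i) (p i) \<noteq> 0" for i
      using e[of i] p[of i] pV[of i] by (auto simp: polynomial_indicator_def)
    show "mpoly_eval (e i) (p j) = 0" if "i < j" for i j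
      using e[of i] later[OF that] pV[of j] by (auto simp: polynomial_indicator_def)
  qed
qed

lemma exists_indecomposable_partition:
  fixes V :: "(nat \<Rightarrow> 'k::field) set"
  assumes "detachable n V U"
  shows "\<exists>F. finite F \<and> F \<noteq> {} \<and> \<Union>F = U \<and> pairwise disjnt F \<and> (\<forall>A \<in> F. indecomposable n V A)"
  using assms
proof (induction U rule: wf_induct_rule[OF wf_detachable[of n V]])
  case (1 U)
  show ?case
  proof (cases "indecomposable n V U")
    case True
    then show ?thesis by (intro exI[of _ "{U}"]) auto
  next
    case False
    then obtain U' where U': "detachable n V U'" "U' \<subset> U" "U' \<noteq> {}"
      using 1(2) by (auto simp: indecomposable_def)
    let ?D = "U - U'"
    have D: "detachable n V ?D" "?D \<subset> U" using detachable_Diff[OF 1(2) U'(1)] U' by auto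
    obtain F where F: "finite F" "F \<noteq> {}" "\<Union>F = U'" "pairwise disjnt F" "\<forall>A \<in> F. indecomposable n V A"
      using 1(1)[of U'] U' 1(2) by auto
    obtain G where G: "finite G" "G \<noteq> {}" "\<Union>G = ?D" "pairwise disjnt G" "\<forall>A \<in> G. indecomposable n V A"
      using 1(1)[of ?D] D 1(2) by auto
    have cross: "disjnt A B" if "A \<in> F" "B \<in> G" for A B
      using that F(3) G(3) by (fastforce simp: disjnt_def)
    have "pairwise disjnt (F \<union> G)"
      using F(4) G(4) cross unfolding pairwise_def by (auto simp: disjnt_sym)
    moreover have "\<Union>(F \<union> G) = U" using F(3) G(3) U'(2) by auto
    ultimately show ?thesis using F G by (intro exI[of _ "F \<union> G"]) auto
  qed
qed

text \<open>
  A unit on an indecomposable part, extended by \<open>1\<close>, is a unit on \<open>V\<close>, hence has finitely many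
  values; Lagrange interpolation then writes the indicator of each of its fibres as a polynomial.
\<close>

lemma indecomposable_unit_constant:
  fixes V :: "(nat \<Rightarrow> 'k::field) set"
  assumes "locally_fundamental n V" "V \<subseteq> affine_space n" "indecomposable n V U"
    and f: "f \<in> mpolys n" "invertible_on n U f"
  shows "mpoly_eval f constant_on U"
proof (cases "U = {}")
  case False
  then obtain u where u: "u \<in> U" by blast
  obtain e where e: "e \<in> mpolys n" "\<And>v. v \<in> V \<Longrightarrow> mpoly_eval e v = (if v \<in> U then 1 else 0)"
    and UV: "U \<subseteq> V"
    using assms(3) by (auto simp: indecomposable_def detachable_def polynomial_indicator_def)
  obtain g where g: "g \<in> mpolys n" "\<And>v. v \<in> U \<Longrightarrow> mpoly_eval f v * mpoly_eval g v = 1"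
    using f(2) by (auto simp: invertible_on_def)
  \<comment> \<open>Equal to h on U and to 1 on the rest of V, so \<open>?ext g\<close> inverts
    \<open>?ext f\<close>.\<close>
  let ?ext = "\<lambda>h. h * e + (1 - e)"
  have ext_mem: "?ext h \<in> mpolys n" if "h \<in> mpolys n" for h
    using that e(1) by (intro mpolys_add mpolys_times mpolys_diff) auto
  have "invertible_on n V (?ext f)"
    unfolding invertible_on_def
    by (rule bexI[OF _ ext_mem[OF g(1)]]) (auto simp: e(2) g(2))
  then have "locally_constant_on_space (subtopology (zariski n) V) (mpoly_eval (?ext f))"
    using assms(1) ext_mem[OF f(1)] unfolding locally_fundamental_iff by blast
  then have fin: "finite (mpoly_eval (?ext f) ` V)"
    by (rule locally_constant_finite_image[OF assms(2)])
  define C where "C = mpoly_eval (?ext f) ` V"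
  let ?c = "mpoly_eval f u"
  \<comment> \<open>A Lagrange polynomial in f: on U it is 1 where f takes the value
    \<open>?c\<close> and 0 at the other values in C; the factor e makes it vanish off U.\<close>
  define l where "l = e * (\<Prod>c\<in>C - {?c}. mconst (1 / (?c - c)) * (f - mconst c))"
  have l_mem: "l \<in> mpolys n"
  proof -
    have "(\<Prod>c\<in>S. mconst (1 / (?c - c)) * (f - mconst c)) \<in> mpolys n" for S
      by (induction S rule: infinite_finite_induct)
        (simp_all add: mpolys_times mpolys_diff f(1))
    then show ?thesis unfolding l_def by (intro mpolys_times e(1))
  qed
  have prod_eval: "mpoly_eval (\<Prod>c\<in>S. h c) v = (\<Prod>c\<in>S. mpoly_eval (h c) v)"
    for S :: "'k set" and h v
    by (induction S rule: infinite_finite_induct) auto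
  let ?U = "{v \<in> U. mpoly_eval f v = ?c}"
  have "mpoly_eval l v = (if v \<in> ?U then 1 else 0)" if v: "v \<in> V" for v
  proof (cases "v \<in> U")
    case True
    have "mpoly_eval (?ext f) v = mpoly_eval f v" using True v e(2) by simp
    then have "mpoly_eval f v \<in> C" using v unfolding C_def by (metis imageI)
    moreover have "finite (C - {?c})" using fin by (simp add: C_def)
    ultimately show ?thesis
      using True v by (auto simp: l_def e(2) prod_eval intro!: prod.neutral)
  qed (use v e(2) in \<open>simp add: l_def\<close>)
  then have "detachable n V ?U"
    using l_mem UV by (auto simp: detachable_def polynomial_indicator_def)
  then have "?U = U" using assms(3) u unfolding indecomposable_def by blast
  then have "U \<subseteq> ?U" by (rule equalityD2)
  then show ?thesis unfolding constant_on_def by auto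
qed (simp add: constant_on_def)

text \<open>The parts of an indecomposable partition have pairwise comaximal vanishing ideals with
  intersection I(V), so the Chinese remainder theorem splits R into their coordinate rings, whose
  units are constant.\<close>

lemma locally_fundamental_imp_locally_unit_additive:
  fixes V :: "(nat \<Rightarrow> 'k::field) set"
  assumes lf: "locally_fundamental n V" and V: "V \<subseteq> affine_space n"
  shows "locally_unit_additive (coordinate_ring n V)"
proof -
  let ?P = "mpoly_ring n :: 'k mpoly ring" and ?R = "coordinate_ring n V"
  interpret P: cring ?P by (rule cring_mpoly_ring)
  interpret R: cring ?R by (rule cring_coordinate_ring)
  obtain F where F: "finite F" "F \<noteq> {}" "\<Union>F = V" "pairwise disjnt F" "\<forall>A \<in> F. indecomposable n V A"
    using exists_indecomposable_partition[OF detachable_self[of n V]]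
    by (elim exE conjE) (rule that)
  \<comment> \<open>The remainder theorem is indexed by \<open>{..m}\<close>, so the partition must
    have a member.\<close>
  obtain m where m: "card F = Suc m" using F(1,2) by (metis card_0_eq not0_implies_Suc)
  obtain h where "bij_betw h {0..<card F} F" using ex_bij_betw_nat_finite[OF F(1)] by blast
  then have h: "bij_betw h {..m} F" by (simp add: m atLeast0LessThan lessThan_Suc_atMost)
  have hF: "h i \<in> F" if "i \<le> m" for i using h that by (auto simp: bij_betw_def)
  let ?I = "\<lambda>i. vanishing_ideal n (h i)"
  have comax: "?I i <+>\<^bsub>?P\<^esub> ?I j = carrier ?P" if ij: "i \<le> m" "j \<le> m" "i \<noteq> j" for i j
  proof -
    have "h i \<noteq> h j" using h ij by (auto simp: bij_betw_def inj_on_def)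
    then have disj: "h i \<inter> h j = {}" using F(4) hF ij by (auto simp: pairwise_def disjnt_def)
    obtain e where e: "e \<in> mpolys n" "\<And>v. v \<in> V \<Longrightarrow> mpoly_eval e v = (if v \<in> h i then 1 else 0)"
      using F(5) hF[OF ij(1)]
      by (auto simp: indecomposable_def detachable_def polynomial_indicator_def)
    have "h i \<subseteq> V" "h j \<subseteq> V" using F(3) hF ij by auto
    \<comment> \<open>The indicator of \<open>h i\<close> splits 1 between the two ideals.\<close>
    then have "1 - e \<in> ?I i" "e \<in> ?I j"
      using e disj by (auto simp: vanishing_ideal_def mpolys_diff subset_iff disjoint_iff)
    then have "(1 - e) \<oplus>\<^bsub>?P\<^esub> e \<in> ?I i <+>\<^bsub>?P\<^esub> ?I j"
      unfolding set_add_def' by blast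
    then have "\<one>\<^bsub>?P\<^esub> \<in> ?I i <+>\<^bsub>?P\<^esub> ?I j" by simp
    then show ?thesis
      using P.add_ideals[OF ideal_vanishing_ideal ideal_vanishing_ideal] ideal.one_imp_carrier by blast
  qed
  have "(\<Inter>i\<le>m. ?I i) = vanishing_ideal n (\<Union>(h ` {..m}))"
    by (auto simp: vanishing_ideal_def)
  also have "h ` {..m} = F" using h by (simp add: bij_betw_def)
  finally have inter: "(\<Inter>i\<le>m. ?I i) = vanishing_ideal n V" using F(3) by simp
  let ?Rs = "map (\<lambda>i. coordinate_ring n (h i)) [0..<Suc m]"
  have "?P Quot (\<Inter>i\<le>m. ?I i) \<simeq> RDirProd_list (map (\<lambda>i. ?P Quot ?I i) [0..<Suc m])"
    by (rule P.chinese_remainder[OF ideal_vanishing_ideal comax])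
  then have iso: "?R \<simeq> RDirProd_list ?Rs"
    unfolding inter coordinate_ring_def .
  have "unit_additive (coordinate_ring n (h i))" if "i \<le> m" for i
    unfolding unit_additive_coordinate_ring_iff
    using indecomposable_unit_constant[OF lf V] F(5) hF[OF that] by blast
  then have "\<forall>S \<in> set ?Rs. unit_additive S" by auto
  moreover have "?R Quot nilradical ?R \<simeq> RDirProd_list ?Rs"
    unfolding nilradical_coordinate_ring
    using ring_iso_trans[OF R.FactRing_zeroideal(1) iso] .
  ultimately show ?thesis
    by (intro locally_unit_additiveI[OF R.is_cring])
qed

section \<open>Products of unit-additive rings\<close>

text \<open>
  In a unit-additive ring every sum \<open>s\<close> of two units agrees with \<open>s\<^sup>2 w\<close> up to nilpotents for some
  \<open>w\<close>. Unlike unit-additivity, this property passes to products.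
\<close>

definition quasi_unit_additive :: "('a, 'm) ring_scheme \<Rightarrow> bool" where
  "quasi_unit_additive R \<longleftrightarrow> (\<forall>u \<in> Units R. \<forall>v \<in> Units R. \<exists>w \<in> carrier R.
     (u \<oplus>\<^bsub>R\<^esub> v) \<ominus>\<^bsub>R\<^esub> (u \<oplus>\<^bsub>R\<^esub> v) \<otimes>\<^bsub>R\<^esub> (u \<oplus>\<^bsub>R\<^esub> v) \<otimes>\<^bsub>R\<^esub> w \<in> nilradical R)"

text \<open>Take w to be the inverse of s if s is a unit, and 0 if s is nilpotent.\<close>

lemma unit_additive_imp_quasi:
  assumes "unit_additive R"
  shows "quasi_unit_additive R"
proof -
  interpret cring R using assms by (simp add: unit_additive_def)
  show ?thesis
    unfolding quasi_unit_additive_def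
  proof (intro ballI)
    fix u v assume "u \<in> Units R" "v \<in> Units R"
    then have uv: "u \<oplus>\<^bsub>R\<^esub> v \<in> carrier R" "u \<oplus>\<^bsub>R\<^esub> v \<in> Units R \<or> u \<oplus>\<^bsub>R\<^esub> v \<in> nilradical R"
      using assms by (auto simp: unit_additive_def)
    let ?s = "u \<oplus>\<^bsub>R\<^esub> v"
    show "\<exists>w \<in> carrier R. ?s \<ominus>\<^bsub>R\<^esub> ?s \<otimes>\<^bsub>R\<^esub> ?s \<otimes>\<^bsub>R\<^esub> w \<in> nilradical R"
    proof (cases "?s \<in> Units R")
      case True
      then have "?s \<otimes>\<^bsub>R\<^esub> ?s \<otimes>\<^bsub>R\<^esub> inv\<^bsub>R\<^esub> ?s = ?s" using uv by (simp add: m_assoc)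
      then have "?s \<ominus>\<^bsub>R\<^esub> ?s \<otimes>\<^bsub>R\<^esub> ?s \<otimes>\<^bsub>R\<^esub> inv\<^bsub>R\<^esub> ?s = \<zero>\<^bsub>R\<^esub>"
        using uv(1) by (simp add: a_minus_def r_neg)
      moreover have "\<zero>\<^bsub>R\<^esub> \<in> nilradical R"
        using nat_pow_eone[of "\<zero>\<^bsub>R\<^esub>"] unfolding nilradical_def by blast
      ultimately show ?thesis using True by (metis Units_inv_closed)
    next
      case False
      then have "?s \<ominus>\<^bsub>R\<^esub> ?s \<otimes>\<^bsub>R\<^esub> ?s \<otimes>\<^bsub>R\<^esub> \<zero>\<^bsub>R\<^esub> \<in> nilradical R"
        using uv by (simp add: a_minus_def)
      then show ?thesis by blast
    qed
  qed
qed

lemma quasi_unit_additive_iso: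
  assumes R: "ring R" and S: "ring S" and f: "f \<in> ring_iso R S" and q: "quasi_unit_additive R"
  shows "quasi_unit_additive S"
proof -
  let ?g = "inv_into (carrier R) f"
  have gi: "?g \<in> ring_iso S R" by (rule ring_iso_set_sym[OF R f])
  interpret R: ring R by fact
  interpret S: ring S by fact
  interpret f: ring_hom_ring R S f
    using f by (intro ring_hom_ringI2 R S) (simp add: ring_iso_def)
  interpret g: ring_hom_ring S R ?g
    using gi by (intro ring_hom_ringI2 R S) (simp add: ring_iso_def)
  have fg: "f (?g y) = y" if "y \<in> carrier S" for y
    using that f by (simp add: ring_iso_def bij_betw_def f_inv_into_f)
  show ?thesis
    unfolding quasi_unit_additive_def
  proof (intro ballI)
    fix u v assume uv: "u \<in> Units S" "v \<in> Units S"
    then have c: "u \<in> carrier S" "v \<in> carrier S" by auto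
    let ?s = "?g u \<oplus>\<^bsub>R\<^esub> ?g v"
    have "?g u \<in> Units R" "?g v \<in> Units R"
      using uv ring_hom_Units_mem[OF S R g.homh] by auto
    then obtain w where w: "w \<in> carrier R" "?s \<ominus>\<^bsub>R\<^esub> ?s \<otimes>\<^bsub>R\<^esub> ?s \<otimes>\<^bsub>R\<^esub> w \<in> nilradical R"
      using q unfolding quasi_unit_additive_def by blast
    have "f (?s \<ominus>\<^bsub>R\<^esub> ?s \<otimes>\<^bsub>R\<^esub> ?s \<otimes>\<^bsub>R\<^esub> w) \<in> nilradical S"
      by (rule ring_hom_nilradical[OF R S f.homh w(2)])
    moreover have "f (?s \<ominus>\<^bsub>R\<^esub> ?s \<otimes>\<^bsub>R\<^esub> ?s \<otimes>\<^bsub>R\<^esub> w) =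
        (u \<oplus>\<^bsub>S\<^esub> v) \<ominus>\<^bsub>S\<^esub> (u \<oplus>\<^bsub>S\<^esub> v) \<otimes>\<^bsub>S\<^esub> (u \<oplus>\<^bsub>S\<^esub> v) \<otimes>\<^bsub>S\<^esub> f w"
      using w(1) c by (simp add: a_minus_def fg)
    ultimately show "\<exists>w \<in> carrier S. (u \<oplus>\<^bsub>S\<^esub> v) \<ominus>\<^bsub>S\<^esub> (u \<oplus>\<^bsub>S\<^esub> v) \<otimes>\<^bsub>S\<^esub> (u \<oplus>\<^bsub>S\<^esub> v) \<otimes>\<^bsub>S\<^esub> w \<in> nilradical S"
      using w(1) by (metis f.hom_closed)
  qed
qed

lemma quasi_unit_additive_RDirProd:
  assumes R: "ring R" and S: "ring S" and q: "quasi_unit_additive R" "quasi_unit_additive S"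
  shows "quasi_unit_additive (RDirProd R S)"
proof -
  let ?T = "RDirProd R S"
  have T: "ring ?T" by (rule RDirProd_ring[OF R S])
  interpret R: ring R by fact
  interpret S: ring S by fact
  interpret T: ring ?T by fact
  have ops: "carrier ?T = carrier R \<times> carrier S"
    "\<And>a b c d. (a, b) \<otimes>\<^bsub>?T\<^esub> (c, d) = (a \<otimes>\<^bsub>R\<^esub> c, b \<otimes>\<^bsub>S\<^esub> d)"
    "\<And>a b c d. (a, b) \<oplus>\<^bsub>?T\<^esub> (c, d) = (a \<oplus>\<^bsub>R\<^esub> c, b \<oplus>\<^bsub>S\<^esub> d)"
    "\<one>\<^bsub>?T\<^esub> = (\<one>\<^bsub>R\<^esub>, \<one>\<^bsub>S\<^esub>)" "\<zero>\<^bsub>?T\<^esub> = (\<zero>\<^bsub>R\<^esub>, \<zero>\<^bsub>S\<^esub>)"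
    by (auto simp: RDirProd_def DirProd_def monoid.defs)
  have uminus: "\<ominus>\<^bsub>?T\<^esub> (a, b) = (\<ominus>\<^bsub>R\<^esub> a, \<ominus>\<^bsub>S\<^esub> b)" if "a \<in> carrier R" "b \<in> carrier S" for a b
    using that by (intro T.minus_equality) (auto simp: ops R.l_neg S.l_neg)
  have pow: "(a, b) [^]\<^bsub>?T\<^esub> (m::nat) = (a [^]\<^bsub>R\<^esub> m, b [^]\<^bsub>S\<^esub> m)" for a b m
    by (induction m) (auto simp: ops)
  have units: "a \<in> Units R \<and> b \<in> Units S" if "(a, b) \<in> Units ?T" for a b
    using that by (auto simp: Units_def ops)
  have nil: "(a, b) \<in> nilradical ?T" if ab: "a \<in> nilradical R" "b \<in> nilradical S" for a b
  proof -
    obtain i j :: nat where ij: "a \<in> carrier R" "b \<in> carrier S"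
      "a [^]\<^bsub>R\<^esub> i = \<zero>\<^bsub>R\<^esub>" "b [^]\<^bsub>S\<^esub> j = \<zero>\<^bsub>S\<^esub>"
      using ab by (auto simp: nilradical_def)
    \<comment> \<open>A common exponent for both components.\<close>
    then have "a [^]\<^bsub>R\<^esub> (i + j) = \<zero>\<^bsub>R\<^esub>" "b [^]\<^bsub>S\<^esub> (i + j) = \<zero>\<^bsub>S\<^esub>"
      by (simp_all add: R.nat_pow_mult[symmetric] S.nat_pow_mult[symmetric])
    then have "(a, b) [^]\<^bsub>?T\<^esub> (i + j) = \<zero>\<^bsub>?T\<^esub>" by (simp add: pow ops)
    then show ?thesis using ij unfolding nilradical_def by (auto simp: ops)
  qed
  show ?thesis
    unfolding quasi_unit_additive_def
  proof (intro ballI)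
    fix x y assume "x \<in> Units ?T" "y \<in> Units ?T"
    then obtain a b c d where xy: "x = (a, b)" "y = (c, d)"
      and u: "a \<in> Units R" "b \<in> Units S" "c \<in> Units R" "d \<in> Units S"
      using units by (metis surj_pair)
    obtain w where w: "w \<in> carrier R"
      "(a \<oplus>\<^bsub>R\<^esub> c) \<ominus>\<^bsub>R\<^esub> (a \<oplus>\<^bsub>R\<^esub> c) \<otimes>\<^bsub>R\<^esub> (a \<oplus>\<^bsub>R\<^esub> c) \<otimes>\<^bsub>R\<^esub> w \<in> nilradical R"
      using q(1) u unfolding quasi_unit_additive_def by blast
    obtain z where z: "z \<in> carrier S"
      "(b \<oplus>\<^bsub>S\<^esub> d) \<ominus>\<^bsub>S\<^esub> (b \<oplus>\<^bsub>S\<^esub> d) \<otimes>\<^bsub>S\<^esub> (b \<oplus>\<^bsub>S\<^esub> d) \<otimes>\<^bsub>S\<^esub> z \<in> nilradical S"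
      using q(2) u unfolding quasi_unit_additive_def by blast
    have "(x \<oplus>\<^bsub>?T\<^esub> y) \<ominus>\<^bsub>?T\<^esub> (x \<oplus>\<^bsub>?T\<^esub> y) \<otimes>\<^bsub>?T\<^esub> (x \<oplus>\<^bsub>?T\<^esub> y) \<otimes>\<^bsub>?T\<^esub> (w, z) \<in> nilradical ?T"
      using nil[OF w(2) z(2)] w(1) z(1) u
      by (simp add: xy ops a_minus_def uminus R.Units_closed S.Units_closed)
    moreover have "(w, z) \<in> carrier ?T" using w(1) z(1) by (simp add: ops)
    ultimately show "\<exists>w \<in> carrier ?T.
        (x \<oplus>\<^bsub>?T\<^esub> y) \<ominus>\<^bsub>?T\<^esub> (x \<oplus>\<^bsub>?T\<^esub> y) \<otimes>\<^bsub>?T\<^esub> (x \<oplus>\<^bsub>?T\<^esub> y) \<otimes>\<^bsub>?T\<^esub> w \<in> nilradical ?T"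
      by blast
  qed
qed

lemma quasi_unit_additive_RDirProd_list:
  fixes Rs :: "'a ring list"
  assumes "\<forall>S \<in> set Rs. unit_additive S"
  shows "ring (RDirProd_list Rs) \<and> quasi_unit_additive (RDirProd_list Rs)"
  using assms
proof (induction Rs)
  case Nil
  let ?N = "RDirProd_list ([] :: 'a ring list)"
  have ring: "ring ?N" by (rule RDirProd_list_is_ring) simp
  interpret ring ?N by (rule ring)
  have nil: "x \<in> nilradical ?N" if "x \<in> carrier ?N" for x
  proof -
    \<comment> \<open>In the zero ring 1 = 0, so every element is nilpotent already with exponent
      0.\<close>
    have "x [^]\<^bsub>?N\<^esub> (0::nat) = \<zero>\<^bsub>?N\<^esub>"
      unfolding nat_pow_0 RDirProd_list_one RDirProd_list_zero by simp
    then show ?thesis using that unfolding nilradical_def by blast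
  qed
  have "quasi_unit_additive ?N"
    unfolding quasi_unit_additive_def
    by (intro ballI bexI[of _ "\<zero>\<^bsub>?N\<^esub>"] nil minus_closed a_closed m_closed zero_closed Units_closed)
  with ring show ?case by blast
next
  case (Cons R Rs)
  then have R: "ring R" "quasi_unit_additive R"
    using unit_additive_imp_quasi[of R] by (auto simp: unit_additive_def cring_def)
  have S: "ring (RDirProd_list Rs)" "quasi_unit_additive (RDirProd_list Rs)" using Cons by auto
  have T: "ring (RDirProd_list (R # Rs))"
    using Cons.prems by (intro RDirProd_list_is_ring) (auto simp: unit_additive_def cring_def set_conv_nth)
  show ?case
    using T quasi_unit_additive_iso[OF RDirProd_ring[OF R(1) S(1)] T RDirProd_list_iso1
        quasi_unit_additive_RDirProd[OF R(1) S(1) R(2) S(2)]] by blast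
qed

text \<open>Put s = f - f(v). As R is reduced, s = s^2 w for some w, so s (1 - s w) vanishes on V.
  The factor 1 - s w is 1 at v, hence nonzero on a neighbourhood of v, and there f equals
  f(v).\<close>

lemma locally_unit_additive_imp_locally_fundamental:
  fixes V :: "(nat \<Rightarrow> 'k::field) set"
  assumes lua: "locally_unit_additive (coordinate_ring n V)" and V: "V \<subseteq> affine_space n"
  shows "locally_fundamental n V"
proof -
  let ?R = "coordinate_ring n V"
  interpret R: cring ?R by (rule cring_coordinate_ring)
  obtain Rs :: "'k mpoly set set ring list" where Rs: "\<forall>S \<in> set Rs. unit_additive S"
    and iso: "?R Quot nilradical ?R \<simeq> RDirProd_list Rs"
    using lua unfolding locally_unit_additive_def by blast
  have T: "ring (RDirProd_list Rs)" "quasi_unit_additive (RDirProd_list Rs)"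
    using quasi_unit_additive_RDirProd_list[OF Rs] by auto
  have "?R \<simeq> RDirProd_list Rs"
    using ring_iso_trans[OF R.FactRing_zeroideal(2)] iso unfolding nilradical_coordinate_ring by blast
  then obtain f where "f \<in> ring_iso (RDirProd_list Rs) ?R"
    using ring_iso_sym[OF R.ring_axioms] by (auto simp: is_ring_iso_def)
  then have q: "quasi_unit_additive ?R"
    using quasi_unit_additive_iso[OF T(1) R.ring_axioms] T(2) by blast
  show ?thesis
    unfolding locally_fundamental_iff locally_constant_on_space_def
  proof (intro ballI impI)
    fix f :: "'k mpoly" and v
    assume f: "f \<in> mpolys n" "invertible_on n V f" and "v \<in> topspace (subtopology (zariski n) V)"
    then have v: "v \<in> V" by simp
    let ?c = "mpoly_eval f v"
    have "?c \<noteq> 0" using f(2) v by (force simp: invertible_on_def)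
    then have "invertible_on n V (mconst (- ?c))" by (intro invertible_on_mconst) simp
    then have "coord_class n V f \<in> Units ?R" "coord_class n V (mconst (- ?c)) \<in> Units ?R"
      using f by (simp_all add: Units_coordinate_ring_iff)
    moreover define s where "s = f + mconst (- ?c)"
    then have s: "s \<in> mpolys n"
      "coord_class n V f \<oplus>\<^bsub>?R\<^esub> coord_class n V (mconst (- ?c)) = coord_class n V s"
      using f by (simp_all add: mpolys_add coordinate_ring_simps)
    ultimately obtain x where x: "x \<in> carrier ?R" "coord_class n V s \<ominus>\<^bsub>?R\<^esub>
        coord_class n V s \<otimes>\<^bsub>?R\<^esub> coord_class n V s \<otimes>\<^bsub>?R\<^esub> x \<in> nilradical ?R"
      using q unfolding quasi_unit_additive_def by metis
    then obtain w where w: "w \<in> mpolys n" "x = coord_class n V w"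
      unfolding carrier_coordinate_ring by blast
    have mem: "coord_class n V p \<in> carrier ?R" if "p \<in> mpolys n" for p
      using that by (simp add: carrier_coordinate_ring)
    have "coord_class n V s = coord_class n V s \<otimes>\<^bsub>?R\<^esub> coord_class n V s \<otimes>\<^bsub>?R\<^esub> x"
      using x(2) R.r_right_minus_eq mem[OF s(1)] x(1)
      unfolding nilradical_coordinate_ring by simp
    then have "coord_class n V s = coord_class n V (s * s * w)"
      using s(1) w by (simp add: coordinate_ring_simps mpolys_times)
    then have eq: "mpoly_eval s p = mpoly_eval s p * mpoly_eval s p * mpoly_eval w p" if "p \<in> V" for p
      using s(1) w(1) that by (simp add: coord_class_eq_iff mpolys_times)
    let ?Z = "{p \<in> affine_space n. \<forall>g \<in> {1 - s * w}. mpoly_eval g p = 0}"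
    have "algebraic_set n ?Z"
      unfolding algebraic_set_def
      by (rule exI[of _ "{1 - s * w}"]) (simp add: mpolys_diff mpolys_times s(1) w(1))
    then have "openin (zariski n) (affine_space n - ?Z)"
      by (simp add: openin_zariski double_diff)
    then have "openin (subtopology (zariski n) V) ((affine_space n - ?Z) \<inter> V)"
      by (auto simp: openin_subtopology)
    moreover have "v \<in> (affine_space n - ?Z) \<inter> V"
      using v V by (auto simp: s_def)
    moreover have "mpoly_eval f constant_on (affine_space n - ?Z) \<inter> V"
      unfolding constant_on_def
    proof (intro exI ballI)
      fix p assume "p \<in> (affine_space n - ?Z) \<inter> V"
      then have "p \<in> V" "1 - mpoly_eval s p * mpoly_eval w p \<noteq> 0" by auto
      moreover have "mpoly_eval s p * (1 - mpoly_eval s p * mpoly_eval w p) = 0"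
        using eq[OF \<open>p \<in> V\<close>] by (simp add: algebra_simps)
      ultimately have "mpoly_eval s p = 0" by simp
      then show "mpoly_eval f p = ?c" by (simp add: s_def)
    qed
    ultimately show "\<exists>U. openin (subtopology (zariski n) V) U \<and> v \<in> U \<and> mpoly_eval f constant_on U"
      by blast
  qed
qed

theorem theorem4p6:
  fixes V :: "(nat \<Rightarrow> 'k::field) set" and n :: nat
  assumes "infinite (UNIV :: 'k set)"
    and "algebraic_set n V"
  shows "(fundamental n V \<longleftrightarrow> unit_additive (coordinate_ring n V)) \<and>
         (locally_fundamental n V \<longleftrightarrow> locally_unit_additive (coordinate_ring n V))"
  using algebraic_set_subset[OF assms(2)] fundamental_iff[of n V]
    unit_additive_coordinate_ring_iff[of n V] locally_fundamental_imp_locally_unit_additive[of n V]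
    locally_unit_additive_imp_locally_fundamental[of n V]
  by blast

end
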